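(* With $R$, $\phi$, $q$, $q_1$, $q_2$ as described in the context, we have $R[x,y]^{\phi }=R[q,q_1,q_2]$.
   Context: Let $R$ be a UFD with $p:=\operatorname{char} R>0$, and let $R[x,y]$ be the polynomial ring in two variables over $R$. Fix $a\in R\setminus\{0\}$ and $\theta(y)=\sum_{i\ge 1}s_iy^i\in yR[y]\setminus\{0\}$ (with $s_i\in R$), and set $f:=ax+\theta(y)$. Fix $0\ne F\in R[f]$, and let $\phi$ be the $R$-algebra automorphism of $R[x,y]$ (the Nagata type automorphism) given by $\phi(y)=y+aF$ and $\phi(x)=x+a^{-1}(\theta(y)-\theta(y+aF))$; it fixes $f$ and $F$, and $R[x,y]^{\phi}=\{g\in R[x,y]\mid \phi(g)=g\}$. Define $q:=y^p-(aF)^{p-1}y$, $d:=\gcd(a,\theta'(y))$, $b:=ad^{-1}$, $t_i:=s_id^{-1}$ for each $i$ with $p\nmid i$, $\rho(y):=\sum_{p\nmid i}t_iy^i$, $\theta^*(y):=\sum_{i\ge1}s_{pi}y^i$ (so $\theta(y)=\theta^*(y^p)+d\rho(y)$), $q_1:=d^{-1}(f-\theta^*(q))$, $\rho^p(T):=\sum_{p\nmid i}t_i^pT^i$ and $\widetilde{q}_1:=b^{1-p}(q_1^p-\rho^p(q))$. Choose $\lambda(x,y)\in R[x,y]$ with $\rho'(y)^p\,y=\lambda(y^p,\rho(y))$ (such $\lambda$ exists because for any ring $S$ of characteristic $p$ and any $g\in S[y]$ one has $(g')^pS[y]\subset S[y^p,g]$), and set $q_2:=b^{-1}\bigl(\widetilde{q}_1-\lambda(q,q_1)(dF)^{p-1}\bigr)$.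 One checks that $q,q_1,q_2$ all lie in $R[x,y]^{\phi}$. *)

theory Defs
  imports "HOL-Computational_Algebra.Computational_Algebra"
begin

text \<open>R[x,y] is represented as 'a poly poly: the outer variable is y,
  the coefficients are polynomials in x over R.\<close>

type_synonym 'a bipoly = "'a poly poly"

definition CC :: "'a::comm_ring_1 \<Rightarrow> 'a bipoly" where
  "CC r = [:[:r:]:]"

definition Xv :: "'a::comm_ring_1 bipoly" where
  "Xv = [:[:0, 1:]:]"

definition Yv :: "'a::comm_ring_1 bipoly" where
  "Yv = [:0, 1:]"

definition inY :: "'a::comm_ring_1 poly \<Rightarrow> 'a bipoly" where
  "inY h = map_poly (\<lambda>r. [:r:]) h"

definition evalY :: "'a::comm_ring_1 poly \<Rightarrow> 'a bipoly \<Rightarrow> 'a bipoly" where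
  "evalY h u = poly (map_poly CC h) u"

definition eval2 :: "'a::comm_ring_1 bipoly \<Rightarrow> 'a bipoly \<Rightarrow> 'a bipoly \<Rightarrow> 'a bipoly" where
  "eval2 g u v = poly (map_poly (\<lambda>c. evalY c u) g) v"

inductive_set subalg :: "'a::comm_ring_1 bipoly set \<Rightarrow> 'a bipoly set" for G where
  const: "CC r \<in> subalg G"
| gen: "g \<in> G \<Longrightarrow> g \<in> subalg G"
| add: "g \<in> subalg G \<Longrightarrow> h \<in> subalg G \<Longrightarrow> g + h \<in> subalg G"
| mult: "g \<in> subalg G \<Longrightarrow> h \<in> subalg G \<Longrightarrow> g * h \<in> subalg G"

context
  fixes a :: "'a::{factorial_ring_gcd, semiring_gcd_mult_normalize}"
    and \<theta> :: "'a poly" and Fp :: "'a poly"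
begin

definition nag_f :: "'a bipoly" where
  "nag_f = CC a * Xv + inY \<theta>"

definition nag_F :: "'a bipoly" where
  "nag_F = evalY Fp nag_f"

definition nag_phi :: "'a bipoly \<Rightarrow> 'a bipoly" where
  "nag_phi g = eval2 g
     (Xv + (inY \<theta> - evalY \<theta> (Yv + CC a * nag_F)) div CC a)
     (Yv + CC a * nag_F)"

definition nag_q :: "'a bipoly" where
  "nag_q = Yv ^ CHAR('a) - (CC a * nag_F) ^ (CHAR('a) - 1) * Yv"

text \<open>d = gcd(a, theta'(y)) computed in R[y]; it is a constant polynomial.\<close>
definition nag_d :: "'a" where
  "nag_d = coeff (gcd [:a:] (pderiv \<theta>)) 0"

definition nag_b :: "'a" where
  "nag_b = a div nag_d"

definition nag_rho :: "'a poly" where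
  "nag_rho = (\<Sum>i\<le>degree \<theta>. if CHAR('a) dvd i then 0 else monom (coeff \<theta> i div nag_d) i)"

definition nag_theta_star :: "'a poly" where
  "nag_theta_star = (\<Sum>i\<le>degree \<theta>. monom (coeff \<theta> (CHAR('a) * i)) i)"

definition nag_q1 :: "'a bipoly" where
  "nag_q1 = (nag_f - evalY nag_theta_star nag_q) div CC nag_d"

definition nag_rho_p :: "'a poly" where
  "nag_rho_p = (\<Sum>i\<le>degree \<theta>. if CHAR('a) dvd i then 0
                 else monom ((coeff \<theta> i div nag_d) ^ CHAR('a)) i)"

definition nag_q1t :: "'a bipoly" where
  "nag_q1t = (nag_q1 ^ CHAR('a) - evalY nag_rho_p nag_q) div CC (nag_b ^ (CHAR('a) - 1))"

definition nag_q2 :: "'a bipoly \<Rightarrow> 'a bipoly" where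
  "nag_q2 lam = (nag_q1t - eval2 lam nag_q nag_q1 * (CC nag_d * nag_F) ^ (CHAR('a) - 1)) div CC nag_b"

end

end

theory Submission
  imports Defs
begin

text \<open>Over the fraction field \<open>K\<close> of \<open>R\<close>, \<open>\<phi>\<close> is the translation \<open>y \<mapsto> y + aF\<close> over \<open>K[f]\<close>, so its
  invariants are \<open>K[f, q]\<close>, and some \<open>a\<^sup>n g\<close> lies in \<open>R[f, q] \<subseteq> R[q, q\<^sub>1]\<close> for every invariant \<open>g\<close>.
  It remains to cancel the primes \<open>\<pi>\<close> of \<open>a = bd\<close>. If \<open>\<pi>\<close> does not divide \<open>b\<close>, then modulo \<open>\<pi>\<close>
  one has \<open>q \<equiv> y\<^sup>p\<close> and \<open>q\<^sub>1 \<equiv> bx + s(y)\<close>, which are independent, so \<open>\<pi>\<close> cancels already in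
  \<open>R[q, q\<^sub>1]\<close>. If \<open>\<pi>\<close> divides \<open>b\<close>, then \<open>q \<equiv> y\<^sup>p\<close>, \<open>q\<^sub>1 \<equiv> \<rho>(y)\<close> and
  \<open>q\<^sub>2 \<equiv> x\<^sup>p + \<alpha>(y) x + \<beta>(y)\<close>. The last one is transcendental over the polynomials in \<open>y\<close>, and,
  since \<open>\<rho>'\<close> does not vanish modulo \<open>\<pi>\<close>, the only relation between the first two is generated by
  \<open>q\<^sub>1\<^sup>p - \<rho>\<^sup>p(q)\<close>, which is divisible by \<open>\<pi>\<close> inside \<open>R[q, q\<^sub>1, q\<^sub>2]\<close> by construction of \<open>q\<^sub>2\<close>.\<close>

section \<open>Evaluation homomorphisms\<close>

text \<open>Covers \<open>CC\<close>, substitutions, \<open>swap\<close> and \<open>nag_phi\<close>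
  alike, so that their algebra is set up once.\<close>

definition is_ring_hom :: "('b::comm_ring_1 \<Rightarrow> 'c::comm_ring_1) \<Rightarrow> bool" where
  "is_ring_hom h \<longleftrightarrow> h 1 = 1 \<and> (\<forall>x y. h (x + y) = h x + h y) \<and> (\<forall>x y. h (x * y) = h x * h y)"

lemma hom_add: "is_ring_hom h \<Longrightarrow> h (x + y) = h x + h y"
  and hom_mult: "is_ring_hom h \<Longrightarrow> h (x * y) = h x * h y"
  and hom_one: "is_ring_hom h \<Longrightarrow> h 1 = 1"
  by (auto simp: is_ring_hom_def)

lemma hom_zero: "is_ring_hom h \<Longrightarrow> h 0 = 0"
  using hom_add[of h 0 0] by simp

lemma hom_diff: "is_ring_hom h \<Longrightarrow> h (x - y) = h x - h y"
  using hom_add[of h "x - y" y] by simp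

lemma hom_power: "is_ring_hom h \<Longrightarrow> h (x ^ n) = h x ^ n"
  by (induction n) (simp_all add: hom_one hom_mult)

lemma hom_dvd: "is_ring_hom h \<Longrightarrow> x dvd y \<Longrightarrow> h x dvd h y"
  by (auto simp: hom_mult)

lemma is_ring_hom_comp: "is_ring_hom g \<Longrightarrow> is_ring_hom h \<Longrightarrow> is_ring_hom (\<lambda>x. g (h x))"
  by (simp add: is_ring_hom_def)

lemma hom_eval_pCons:
  "is_ring_hom h \<Longrightarrow> poly (map_poly h (pCons c P)) z = h c + z * poly (map_poly h P) z"
  by (simp add: map_poly_pCons hom_zero)

lemma map_poly_hom_add:
  "is_ring_hom h \<Longrightarrow> map_poly h (P + Q) = map_poly h P + map_poly h Q"
  by (intro poly_eqI) (simp add: coeff_map_poly hom_zero hom_add)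

lemma is_ring_hom_eval:
  assumes "is_ring_hom h"
  shows "is_ring_hom (\<lambda>P. poly (map_poly h P) z)"
proof -
  have smult: "poly (map_poly h (smult c Q)) z = h c * poly (map_poly h Q) z" for c Q
    by (simp add: map_poly_smult hom_zero hom_mult assms)
  have "poly (map_poly h (P * Q)) z = poly (map_poly h P) z * poly (map_poly h Q) z" for P Q
    by (induction P)
       (simp_all add: hom_eval_pCons map_poly_hom_add hom_zero smult assms algebra_simps)
  then show ?thesis
    by (simp add: is_ring_hom_def map_poly_hom_add[OF assms] hom_one[OF assms])
qed

lemma is_ring_hom_pcompose: "is_ring_hom (\<lambda>h. pcompose h w)"
  by (simp add: is_ring_hom_def pcompose_add pcompose_mult pcompose_1)

lemma is_ring_hom_CC: "is_ring_hom CC"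
  by (simp add: is_ring_hom_def CC_def one_pCons)

lemma is_ring_hom_evalY: "is_ring_hom (\<lambda>h. evalY h u)"
  unfolding evalY_def by (rule is_ring_hom_eval[OF is_ring_hom_CC])

lemma is_ring_hom_eval2: "is_ring_hom (\<lambda>g. eval2 g u v)"
  unfolding eval2_def by (rule is_ring_hom_eval[OF is_ring_hom_evalY])

lemma evalY_pCons: "evalY (pCons c h) u = CC c + u * evalY h u"
  unfolding evalY_def by (rule hom_eval_pCons[OF is_ring_hom_CC])

lemma eval2_pCons: "eval2 (pCons c g) u v = evalY c u + v * eval2 g u v"
  unfolding eval2_def by (rule hom_eval_pCons[OF is_ring_hom_evalY])

lemma evalY_0 [simp]: "evalY 0 u = 0"
  by (simp add: evalY_def)

lemma eval2_0 [simp]: "eval2 0 u v = 0"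
  by (simp add: eval2_def)

lemma evalY_const [simp]: "evalY [:c:] u = CC c"
  by (simp add: evalY_pCons)

lemma eval2_const [simp]: "eval2 [:h:] u v = evalY h u"
  by (simp add: eval2_pCons)

lemma inY_pCons: "inY (pCons c h) = pCons [:c:] (inY h)"
  by (simp add: inY_def map_poly_pCons)

lemma inY_0 [simp]: "inY 0 = 0"
  by (simp add: inY_def)

lemma inY_const [simp]: "inY [:c:] = CC c"
  by (simp add: inY_pCons CC_def)

lemma CC_0 [simp]: "CC 0 = 0" and CC_1 [simp]: "CC 1 = 1"
  by (simp_all add: CC_def one_pCons)

lemma CC_eq_0_iff [simp]: "CC c = 0 \<longleftrightarrow> c = 0"
  by (simp add: CC_def)

lemma CC_mult: "CC (c * d) = CC c * CC d"
  by (simp add: CC_def)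

lemma CC_minus_1 [simp]: "CC (-1) = -1"
  by (simp add: CC_def one_pCons)

lemma CC_power: "CC (c ^ n) = CC c ^ n"
  by (rule hom_power[OF is_ring_hom_CC])

lemma inY_eq_evalY: "inY h = evalY h Yv"
  by (induction h) (simp_all add: inY_pCons evalY_pCons Yv_def CC_def)

lemma is_ring_hom_inY: "is_ring_hom inY"
  by (simp add: is_ring_hom_evalY inY_eq_evalY[abs_def])

lemma eval2_CC [simp]: "eval2 (CC r) u v = CC r"
  by (simp add: CC_def evalY_pCons)

lemma eval2_Xv [simp]: "eval2 Xv u v = u"
  by (simp add: Xv_def evalY_pCons)

lemma eval2_Yv [simp]: "eval2 Yv u v = v"
  by (simp add: Yv_def eval2_pCons hom_one[OF is_ring_hom_evalY])

lemmas eval2_hom = hom_add[OF is_ring_hom_eval2] hom_mult[OF is_ring_hom_eval2]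
  hom_power[OF is_ring_hom_eval2] hom_diff[OF is_ring_hom_eval2]

text \<open>\<open>Xv\<close> and \<open>Yv\<close> generate the ring over the constants; the rule
  hides the nested representation.\<close>

lemma bipoly_induct [case_names const X Y add mult]:
  assumes "\<And>r. P (CC r)" "P Xv" "P Yv"
    and "\<And>g h. P g \<Longrightarrow> P h \<Longrightarrow> P (g + h)" "\<And>g h. P g \<Longrightarrow> P h \<Longrightarrow> P (g * h)"
  shows "P g"
proof (induction g)
  case 0
  show ?case using assms(1)[of 0] by simp
next
  case (pCons c g)
  have "P [:c:]" for c
  proof (induction c)
    case 0
    show ?case using assms(1)[of 0] by simp
  next
    case (pCons r c)
    have "[:pCons r c:] = CC r + Xv * [:c:]"
      by (simp add: CC_def Xv_def)
    then show ?case using assms pCons by metis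
  qed
  moreover have "pCons c g = [:c:] + Yv * g"
    by (simp add: Yv_def)
  ultimately show ?case using assms pCons by metis
qed

lemma bipoly_hom_eqI:
  assumes "is_ring_hom h" "is_ring_hom k"
    and "\<And>r. h (CC r) = k (CC r)" "h Xv = k Xv" "h Yv = k Yv"
  shows "h g = k g"
  by (induction g rule: bipoly_induct) (use assms in \<open>simp_all add: hom_add hom_mult\<close>)

lemma eval2_eval2: "eval2 (eval2 g u v) s t = eval2 g (eval2 u s t) (eval2 v s t)"
  by (rule bipoly_hom_eqI[of "\<lambda>g. eval2 (eval2 g u v) s t"])
     (auto intro: is_ring_hom_comp is_ring_hom_eval2)

lemma eval2_evalY: "eval2 (evalY h u) s t = evalY h (eval2 u s t)"
  using eval2_eval2[of "[:h:]" u] by simp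

lemma eval2_inY: "eval2 (inY h) s t = evalY h t"
  by (simp add: inY_eq_evalY eval2_evalY)

lemma evalY_pcompose: "evalY (pcompose h w) u = evalY h (evalY w u)"
  by (induction h)
     (simp_all add: pcompose_pCons evalY_pCons hom_add[OF is_ring_hom_evalY] hom_mult[OF is_ring_hom_evalY])

text \<open>Later replaces \<open>q\<close> and \<open>q1\<close> by their reductions modulo a prime
  inside an arbitrary polynomial expression.\<close>

lemma eval2_dvd_diff:
  assumes "c dvd u - u'" "c dvd v - v'"
  shows "c dvd eval2 g u v - eval2 g u' v'"
proof (induction g rule: bipoly_induct)
  case (add g h)
  have "eval2 (g + h) u v - eval2 (g + h) u' v' =
      (eval2 g u v - eval2 g u' v') + (eval2 h u v - eval2 h u' v')"
    by (simp add: eval2_hom)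
  with add show ?case by (metis dvd_add)
next
  case (mult g h)
  have "eval2 (g * h) u v - eval2 (g * h) u' v' =
      eval2 g u v * (eval2 h u v - eval2 h u' v') + eval2 h u' v' * (eval2 g u v - eval2 g u' v')"
    by (simp add: eval2_hom algebra_simps)
  with mult show ?case by (metis dvd_add dvd_mult)
qed (use assms in simp_all)

lemma evalY_const_poly: "evalY c [:w:] = [:pcompose c w:]"
  by (induction c) (simp_all add: evalY_pCons pcompose_pCons CC_def)

text \<open>After \<open>swap\<close>, the reductions of \<open>q\<close> and \<open>q1\<close>
  modulo a prime of \<open>b\<close> are constants for the outer variable, which is the shape
  treated here.\<close>

lemma eval2_const_const:
  "eval2 P [:w:] [:r:] = [:poly (map_poly (\<lambda>c. pcompose c w) P) r:]"
  by (induction P)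
     (simp_all add: eval2_pCons hom_eval_pCons[OF is_ring_hom_pcompose] evalY_const_poly)

lemma eval2_const_eq_pcompose:
  "eval2 P [:w:] Q = pcompose (map_poly (\<lambda>c. pcompose c w) P) Q"
  by (induction P) (simp_all add: eval2_pCons pcompose_pCons map_poly_pCons evalY_const_poly)

text \<open>Exchanging \<open>x\<close> and \<open>y\<close> makes \<open>x\<close> the outer variable, in which \<open>q\<^sub>2\<close> is monic modulo primes of \<open>b\<close>.\<close>

definition swap :: "'a::comm_ring_1 bipoly \<Rightarrow> 'a bipoly" where
  "swap g = eval2 g Yv Xv"

lemma is_ring_hom_swap: "is_ring_hom swap"
  by (simp add: swap_def[abs_def] is_ring_hom_eval2)

lemmas swap_hom = hom_add[OF is_ring_hom_swap] hom_mult[OF is_ring_hom_swap]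
  hom_power[OF is_ring_hom_swap] hom_diff[OF is_ring_hom_swap]

lemma swap_simps [simp]: "swap (CC r) = CC r" "swap Xv = Yv" "swap Yv = Xv"
  by (simp_all add: swap_def)

lemma swap_inY [simp]: "swap (inY h) = [:h:]"
  unfolding swap_def eval2_inY by (induction h) (simp_all add: evalY_pCons Xv_def CC_def)

lemma swap_swap [simp]: "swap (swap g) = g"
  by (rule bipoly_hom_eqI[of "\<lambda>g. swap (swap g)" "\<lambda>g. g"])
     (auto intro: is_ring_hom_comp is_ring_hom_swap simp: is_ring_hom_def swap_hom hom_one[OF is_ring_hom_swap])

lemma swap_eval2: "swap (eval2 g u v) = eval2 g (swap u) (swap v)"
  by (simp add: swap_def eval2_eval2)

lemma CC_dvd_swap_iff: "CC c dvd swap g \<longleftrightarrow> CC c dvd g"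
  using hom_dvd[OF is_ring_hom_swap, of "CC c" g] hom_dvd[OF is_ring_hom_swap, of "CC c" "swap g"]
  by auto

lemma CC_dvd_iff: "CC (c::'a::idom) dvd g \<longleftrightarrow> (\<forall>i. [:c:] dvd coeff g i)"
  unfolding CC_def by (rule const_poly_dvd_iff)

section \<open>Divisibility by a prime constant\<close>

text \<open>The leading coefficient of the composite is that of \<open>P\<close> times a power of
  that of \<open>Q\<close>, so \<open>c\<close> divides the top term of \<open>P\<close>, which can
  then be removed.\<close>

lemma const_dvd_pcompose:
  fixes P Q :: "'s::idom poly"
  assumes "prime_elem c" "degree Q > 0" "\<not> c dvd lead_coeff Q" "[:c:] dvd pcompose P Q"
  shows "[:c:] dvd P"
  using assms(4)
proof (induction "degree P" arbitrary: P rule: less_induct)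
  case less
  let ?n = "degree P"
  have "c dvd lead_coeff (pcompose P Q)"
    using less.prems by (simp add: const_poly_dvd_iff)
  then have lc: "c dvd lead_coeff P"
    using assms(1-3) by (simp add: lead_coeff_comp prime_elem_dvd_mult_iff)
       (meson prime_elem_dvd_power)
  show ?case
  proof (cases "?n = 0")
    case True
    then obtain k where "P = [:k:]" by (rule degree_eq_zeroE)
    with lc show ?thesis by simp
  next
    case False
    define P' where "P' = P - monom (lead_coeff P) ?n"
    have m: "[:c:] dvd monom (lead_coeff P) ?n"
      using lc by (auto simp: const_poly_dvd_iff)
    then obtain k where "monom (lead_coeff P) ?n = [:c:] * k" ..
    then have "pcompose (monom (lead_coeff P) ?n) Q = [:c:] * pcompose k Q"
      by (metis pcompose_mult pcompose_const)
    then have "[:c:] dvd pcompose P' Q"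
      using less.prems unfolding P'_def pcompose_diff by (metis dvd_diff dvd_triv_left)
    moreover have "degree P' < ?n"
    proof (rule degree_lessI)
      show "P' \<noteq> 0 \<or> 0 < ?n" using False by simp
      show "\<forall>k\<ge>?n. coeff P' k = 0"
        by (auto simp: P'_def coeff_eq_0 le_less)
    qed
    ultimately have "[:c:] dvd P'" by (rule less.hyps[rotated])
    with m have "[:c:] dvd P' + monom (lead_coeff P) ?n" by (rule dvd_add[rotated])
    then show ?thesis by (simp add: P'_def)
  qed
qed

text \<open>Pseudo-division multiplies the dividend by a power of the leading coefficient, which is
  1 here.\<close>

lemma monic_division:
  fixes P H :: "'s::idom poly"
  assumes "lead_coeff H = 1"
  obtains Q Rm where "P = H * Q + Rm" "Rm = 0 \<or> degree Rm < degree H"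
proof -
  obtain Q Rm where qr: "pseudo_divmod P H = (Q, Rm)" by fastforce
  have "H \<noteq> 0" using assms by auto
  from pseudo_divmod[OF this qr] assms that show thesis by simp
qed


section \<open>Integer factors and derivatives in characteristic p\<close>

lemma of_nat_unit:
  assumes "prime CHAR('s::comm_ring_1)" "\<not> CHAR('s) dvd n"
  obtains m where "of_nat n * (of_nat m :: 's) = 1"
proof -
  have "coprime n CHAR('s)"
    using prime_imp_coprime[OF assms] by (simp add: coprime_commute)
  moreover have "n \<noteq> 0" using assms(2) by (intro notI) simp
  ultimately obtain x y where "n * x = CHAR('s) * y + 1"
    using bezout_nat[of n "CHAR('s)"] by auto
  then have "of_nat (n * x) = (of_nat (CHAR('s) * y + 1) :: 's)" by simp
  then have "of_nat n * (of_nat x :: 's) = 1" by simp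
  with that show thesis by blast
qed

lemma dvd_of_nat_mult_cancel:
  fixes c z :: "'s::comm_ring_1"
  assumes "prime CHAR('s)" "\<not> CHAR('s) dvd n" "c dvd of_nat n * z"
  shows "c dvd z"
proof -
  obtain m where m: "of_nat n * (of_nat m :: 's) = 1" using of_nat_unit assms(1,2) .
  have "of_nat n * z * of_nat m = of_nat n * of_nat m * z" by (simp add: mult_ac)
  then have "z = of_nat n * z * of_nat m" using m by simp
  then show ?thesis using assms(3) by (metis dvd_mult2)
qed

text \<open>Fermat's little theorem, by induction from the additivity of the p-th power.\<close>

lemma of_nat_power_CHAR:
  assumes "prime CHAR('s::comm_ring_1)"
  shows "(of_nat n :: 's) ^ CHAR('s) = of_nat n"
proof (induction n)
  case 0
  then show ?case using prime_gt_0_nat[OF assms] by (simp add: power_0_left)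
next
  case (Suc n)
  then show ?case using freshmans_dream[OF assms refl, of 1 "of_nat n"] by simp
qed

text \<open>Chain rule: as \<open>w\<close> has zero derivative, coefficients composed with
  \<open>w\<close> behave as constants and only \<open>r\<close> contributes.\<close>

lemma pderiv_eval_pcompose:
  fixes w r :: "'a::idom poly"
  assumes "pderiv w = 0"
  shows "pderiv (poly (map_poly (\<lambda>c. pcompose c w) P) r) =
    pderiv r * poly (map_poly (\<lambda>c. pcompose c w) (pderiv P)) r"
proof (induction P)
  case (pCons c P)
  show ?case
    by (simp add: hom_eval_pCons[OF is_ring_hom_pcompose] pderiv_pCons pderiv_add pderiv_mult
        pderiv_pcompose assms pCons.IH map_poly_hom_add[OF is_ring_hom_pcompose] algebra_simps)
qed simp

text \<open>With \<open>w = y\<^sup>p\<close> this says that \<open>1, r, \<dots>, r\<^sup>p\<^sup>-\<^sup>1\<close> are independent over the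
  polynomials in \<open>y\<^sup>p\<close> modulo \<open>c\<close>: differentiating lowers the degree in \<open>r\<close>.\<close>

lemma const_dvd_eval_pcompose:
  fixes w r :: "'a::idom poly"
  assumes "prime_elem c" "prime CHAR('a)" "\<not> [:c:] dvd pderiv r"
    and "degree w > 0" "\<not> c dvd lead_coeff w" "pderiv w = 0"
    and "degree P < CHAR('a)" "[:c:] dvd poly (map_poly (\<lambda>c. pcompose c w) P) r"
  shows "[:[:c:]:] dvd P"
  using assms(7,8)
proof (induction "degree P" arbitrary: P rule: less_induct)
  case less
  let ?h = "\<lambda>P. poly (map_poly (\<lambda>c. pcompose c w) P) r"
  have hom: "is_ring_hom ?h" by (rule is_ring_hom_eval[OF is_ring_hom_pcompose])
  obtain k P' where P: "P = pCons k P'" by (cases P)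
  have "[:[:c:]:] dvd P'"
  proof (cases "degree P = 0")
    case True
    then have "P' = 0" using P by (simp split: if_splits)
    then show ?thesis by simp
  next
    case False
    obtain z where "?h P = [:c:] * z" using less.prems(2) ..
    then have "pderiv (?h P) = [:c:] * pderiv z" by (simp add: pderiv_smult)
    then have "[:c:] dvd pderiv r * ?h (pderiv P)"
      unfolding pderiv_eval_pcompose[OF assms(6)] by (metis dvd_triv_left)
    \<comment> \<open>The prime \<open>c\<close> does not divide \<open>pderiv r\<close>, so it
      passes to the other factor, where the degree in \<open>r\<close> is lower.\<close>
    then have "[:c:] dvd ?h (pderiv P)"
      using assms(1,3) lift_prime_elem_poly prime_elem_dvd_mult_iff by blast
    moreover have "degree (pderiv P) \<le> degree P - 1"
      by (rule degree_le) (simp add: coeff_pderiv coeff_eq_0)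
    then have "degree (pderiv P) < degree P" using False by linarith
    ultimately have "[:[:c:]:] dvd pderiv P"
      using less.hyps less.prems(1) by simp
    then have d: "[:c:] dvd of_nat (Suc n) * coeff P (Suc n)" for n
      unfolding const_poly_dvd_iff[of "[:c:]"] coeff_pderiv by blast
    have "[:c:] dvd coeff P' n" for n
    proof (cases "Suc n \<le> degree P")
      case True
      \<comment> \<open>Exponents in \<open>P\<close> are below p, so the integer factors produced
        by differentiation are units.\<close>
      then have "\<not> CHAR('a) dvd Suc n" using less.prems(1) by (auto dest: dvd_imp_le)
      then have "[:c:] dvd coeff P (Suc n)"
        using dvd_of_nat_mult_cancel[OF _ _ d] assms(2) by simp
      then show ?thesis by (simp add: P)
    next
      case False
      then have "coeff P (Suc n) = 0" by (simp add: coeff_eq_0)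
      then show ?thesis by (simp add: P)
    qed
    then show ?thesis unfolding const_poly_dvd_iff[of "[:c:]"] by blast
  qed
  moreover have "[:c:] dvd k"
  proof -
    have "?h [:[:c:]:] = [:c:]" by (simp add: map_poly_pCons)
    then have "[:c:] dvd ?h P'"
      using hom_dvd[OF hom \<open>[:[:c:]:] dvd P'\<close>] by simp
    moreover have "?h P = pcompose k w + r * ?h P'"
      by (simp add: P hom_eval_pCons[OF is_ring_hom_pcompose])
    ultimately have "[:c:] dvd pcompose k w"
      using less.prems(2) by (metis dvd_add_left_iff dvd_mult)
    then show ?thesis by (rule const_dvd_pcompose[OF assms(1,4,5)])
  qed
  ultimately show ?case
    unfolding const_poly_dvd_iff[of "[:c:]"] P by (auto simp: coeff_pCons split: nat.splits)
qed

section \<open>Polynomials invariant under a translation\<close>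

text \<open>Division by the monic invariant T^p - u^(p-1) T leaves an invariant quotient and an
  invariant remainder; the remainder is constant and induction applies to the quotient.\<close>

lemma translation_invariant:
  fixes P :: "'s::idom poly"
  assumes "prime CHAR('s)" "u \<noteq> 0" "pcompose P [:u, 1:] = P"
  shows "\<exists>Q. P = pcompose Q ([:0, 1:] ^ CHAR('s) - smult (u ^ (CHAR('s) - 1)) [:0, 1:])"
  using assms(3)
proof (induction "degree P" arbitrary: P rule: less_induct)
  case less
  let ?p = "CHAR('s)"
  define H where "H = [:0, 1:] ^ ?p - smult (u ^ (?p - 1)) [:0, 1:]"
  let ?T = "\<lambda>P. pcompose P [:u, 1:]"
  have p2: "?p \<ge> 2" using assms(1) by (rule prime_ge_2_nat)
  have Hm: "H = monom 1 ?p - monom (u ^ (?p - 1)) 1"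
    by (simp add: H_def monom_altdef)
  have degH: "degree H = ?p"
  proof (rule antisym)
    show "degree H \<le> ?p" unfolding Hm using p2
      by (intro degree_diff_le order.trans[OF degree_monom_le]) auto
    show "?p \<le> degree H" using p2 by (intro le_degree) (simp add: Hm)
  qed
  then have lcH: "lead_coeff H = 1" using p2 by (simp add: Hm)
  have "([:u:] + [:0, 1:]) ^ ?p = [:u:] ^ ?p + [:0, 1:] ^ ?p"
    by (rule freshmans_dream) (use assms(1) in simp_all)
  moreover have "[:u:] ^ ?p = [:u ^ (?p - 1) * u:]"
    using p2 power_minus_mult[of ?p u] by (simp add: poly_const_pow)
  ultimately have "[:u, 1:] ^ ?p = [:u ^ (?p - 1) * u:] + [:0, 1:] ^ ?p"
    by simp
  moreover have "?T H = [:u, 1:] ^ ?p - smult (u ^ (?p - 1)) [:u, 1:]"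
    by (simp add: H_def pcompose_diff pcompose_smult pcompose_pCons
        hom_power[OF is_ring_hom_pcompose])
  ultimately have TH: "?T H = H" by (simp add: H_def)
  obtain Q Rm where QR: "P = H * Q + Rm" "Rm = 0 \<or> degree Rm < degree H"
    using monic_division[OF lcH] .
  have degT: "degree (?T Z) = degree Z" for Z :: "'s poly"
    by (simp add: degree_pcompose)
  have eq: "H * (Q - ?T Q) = ?T Rm - Rm"
  proof -
    have "H * ?T Q + ?T Rm = H * Q + Rm"
      using less.prems unfolding QR(1) pcompose_add pcompose_mult TH .
    then show ?thesis by (simp add: algebra_simps)
  qed
  \<comment> \<open>Otherwise the left side of \<open>eq\<close> has degree at least p and the right
    side degree below p.\<close>
  have Q: "?T Q = Q"
  proof (rule ccontr)
    assume "?T Q \<noteq> Q"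
    then have "degree (H * (Q - ?T Q)) \<ge> ?p"
      using degH p2 by (subst degree_mult_eq) auto
    moreover have "degree (?T Rm - Rm) < ?p"
    proof -
      have "degree Rm < ?p" using QR(2) degH p2 by auto
      then show ?thesis by (intro degree_diff_less) (simp_all add: degT)
    qed
    ultimately show False using eq by simp
  qed
  then have R: "?T Rm = Rm" using eq by simp
  \<comment> \<open>The remainder has degree below p but takes a single value at the p distinct
    points \<open>of_nat i * u\<close>, which forces it to be constant.\<close>
  have "poly Rm (of_nat i * u) = poly Rm 0" for i
  proof (induction i)
    case (Suc i)
    have "poly Rm (of_nat (Suc i) * u) = poly (?T Rm) (of_nat i * u)"
      by (simp add: poly_pcompose algebra_simps)
    with Suc R show ?case by simp
  qed simp
  then have roots: "(\<lambda>i. of_nat i * u) ` {..<?p} \<subseteq> {x. poly (Rm - [:poly Rm 0:]) x = 0}"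
    by auto
  have inj: "inj_on (\<lambda>i. of_nat i * u) {..<?p}"
  proof (rule linorder_inj_onI)
    fix i j assume ij: "i < j" "i \<in> {..<?p}" "j \<in> {..<?p}"
    show "of_nat i * u \<noteq> of_nat j * u"
    proof
      assume "of_nat i * u = of_nat j * u"
      then have "of_nat (j - i) = (0 :: 's)"
        using assms(2) ij by simp
      then have "?p dvd j - i" by (simp add: of_nat_eq_0_iff_char_dvd)
      with ij show False by (auto dest: dvd_imp_le)
    qed
  qed auto
  have Rc: "Rm = [:poly Rm 0:]"
  proof (rule ccontr)
    assume "Rm \<noteq> [:poly Rm 0:]"
    then have nz: "Rm - [:poly Rm 0:] \<noteq> 0" by simp
    have "?p = card ((\<lambda>i. of_nat i * u) ` {..<?p})" using inj by (simp add: card_image)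
    also have "\<dots> \<le> card {x. poly (Rm - [:poly Rm 0:]) x = 0}"
      by (rule card_mono[OF poly_roots_finite[OF nz] roots])
    also have "\<dots> \<le> degree (Rm - [:poly Rm 0:])" by (rule card_poly_roots_bound[OF nz])
    also have "\<dots> < ?p" using QR(2) degH p2 by (intro degree_diff_less) auto
    finally show False by simp
  qed
  have "\<exists>Q'. Q = pcompose Q' H"
  proof (cases "Q = 0")
    case True
    then show ?thesis by (intro exI[of _ 0]) simp
  next
    case False
    have "H \<noteq> 0" using lcH by auto
    then have HQ: "degree (H * Q) = ?p + degree Q"
      using False degH by (simp add: degree_mult_eq)
    then have "degree P = degree (H * Q)"
      unfolding QR(1) using p2 by (subst Rc) (simp add: degree_add_eq_left)
    then have "degree Q < degree P" using HQ p2 by simp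
    from less.hyps[OF this Q] show ?thesis by (simp add: H_def)
  qed
  then obtain Q' where "Q = pcompose Q' H" ..
  moreover have "pcompose [:0, 1:] H = H" by (simp add: pcompose_pCons)
  ultimately have "P = pcompose ([:0, 1:] * Q' + [:poly Rm 0:]) H"
    using QR(1) Rc by (metis pcompose_add pcompose_mult pcompose_const)
  then show ?case unfolding H_def by blast
qed

section \<open>Congruences in subalgebras\<close>

text \<open>A closure predicate beside the inductive \<open>subalg\<close>, because
  \<open>modY c\<close> and the whole ring must be covered too.\<close>

definition is_subalg :: "'a::comm_ring_1 bipoly set \<Rightarrow> bool" where
  "is_subalg S \<longleftrightarrow> (\<forall>r. CC r \<in> S) \<and> (\<forall>g\<in>S. \<forall>h\<in>S. g + h \<in> S \<and> g * h \<in> S)"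

lemma
  assumes "is_subalg S"
  shows subalg_CC: "CC r \<in> S"
    and subalg_add: "g \<in> S \<Longrightarrow> h \<in> S \<Longrightarrow> g + h \<in> S"
    and subalg_mult: "g \<in> S \<Longrightarrow> h \<in> S \<Longrightarrow> g * h \<in> S"
  using assms by (auto simp: is_subalg_def)

lemma subalg_power: "is_subalg S \<Longrightarrow> g \<in> S \<Longrightarrow> g ^ n \<in> S"
  by (induction n) (use subalg_CC[of S 1] in \<open>auto intro: subalg_mult\<close>)

lemma subalg_diff:
  assumes "is_subalg S" "g \<in> S" "h \<in> S"
  shows "g - h \<in> S"
proof -
  have "g - h = g + CC (-1) * h" by simp
  then show ?thesis
    using subalg_add[OF assms(1,2) subalg_mult[OF assms(1) subalg_CC[OF assms(1)] assms(3)]] by metis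
qed

lemmas subalg_intros = subalg_CC subalg_add subalg_mult subalg_power subalg_diff

lemma subalg_evalY: "is_subalg S \<Longrightarrow> u \<in> S \<Longrightarrow> evalY h u \<in> S"
  by (induction h) (use subalg_CC[of S 0] in \<open>auto simp: evalY_pCons intro: subalg_intros\<close>)

lemma subalg_eval2: "is_subalg S \<Longrightarrow> u \<in> S \<Longrightarrow> v \<in> S \<Longrightarrow> eval2 g u v \<in> S"
  by (induction g rule: bipoly_induct) (auto simp: eval2_hom intro: subalg_intros)

text \<open>The point is that the cofactor stays in \<open>S\<close>: with
  \<open>S = modY a\<close>, error terms remain polynomials in y modulo \<open>a\<close>.\<close>

lemma evalY_diff_factor:
  assumes "is_subalg S" "u \<in> S" "v \<in> S"
  shows "\<exists>G\<in>S. evalY h u - evalY h v = (u - v) * G"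
proof (induction h)
  case 0
  then show ?case using subalg_CC[OF assms(1), of 0] by (intro bexI[of _ 0]) simp_all
next
  case (pCons c h)
  then obtain G where G: "G \<in> S" "evalY h u - evalY h v = (u - v) * G" by blast
  have "evalY (pCons c h) u - evalY (pCons c h) v =
      (u - v) * evalY h u + v * (evalY h u - evalY h v)"
    by (simp add: evalY_pCons algebra_simps)
  also have "\<dots> = (u - v) * (evalY h u + v * G)"
    unfolding G(2) by (simp add: algebra_simps)
  finally show ?case
    using assms G(1) by (auto intro: subalg_intros subalg_evalY)
qed

text \<open>The derivative is taken at \<open>u\<close>, which will be y^p, because there the
  derivative of \<open>\<rho>p\<close> is a p-th power.\<close>

lemma evalY_taylor:
  assumes "is_subalg S" "u \<in> S" "v \<in> S"
  shows "\<exists>W\<in>S. evalY h u - evalY h v = (u - v) * evalY (pderiv h) u + (u - v)\<^sup>2 * W"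
proof (induction h)
  case 0
  then show ?case using subalg_CC[OF assms(1), of 0] by (intro bexI[of _ 0]) simp_all
next
  case (pCons c h)
  then obtain W where W: "W \<in> S" "evalY h u - evalY h v = (u - v) * evalY (pderiv h) u + (u - v)\<^sup>2 * W" by blast
  have "evalY (pCons c h) u - evalY (pCons c h) v =
      (u - v) * evalY h u + v * (evalY h u - evalY h v)"
    by (simp add: evalY_pCons algebra_simps)
  also have "\<dots> = (u - v) * (evalY h u + u * evalY (pderiv h) u)
      + (u - v)\<^sup>2 * (v * W - evalY (pderiv h) u)"
    unfolding W(2) by (simp add: algebra_simps power2_eq_square)
  also have "evalY h u + u * evalY (pderiv h) u = evalY (pderiv (pCons c h)) u"
    by (simp add: pderiv_pCons hom_add[OF is_ring_hom_evalY] evalY_pCons)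
  finally show ?case
    using assms W(1) by (auto intro: subalg_intros subalg_evalY)
qed

text \<open>The subalgebras \<open>R[y] + c R[x, y]\<close> and, as a module over it, \<open>R[y] x + R[y] + c R[x, y]\<close>.\<close>

definition modY :: "'a::comm_ring_1 \<Rightarrow> 'a bipoly set" where
  "modY c = {g. \<exists>h. CC c dvd g - inY h}"

lemma CC_dvd_diff_mult:
  fixes c g g' h h' :: "'s::comm_ring_1"
  assumes "c dvd g - g'" "c dvd h - h'"
  shows "c dvd g * h - g' * h'"
proof -
  have "g * h - g' * h' = g * (h - h') + h' * (g - g')" by (simp add: algebra_simps)
  then show ?thesis using assms by (metis dvd_add dvd_mult)
qed

lemma dvd_diff_add:
  fixes c g g' h h' :: "'s::comm_ring_1"
  assumes "c dvd g - g'" "c dvd h - h'"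
  shows "c dvd (g + h) - (g' + h')"
  using dvd_add[OF assms] by (simp add: algebra_simps)

lemma dvd_of_dvd_diff:
  fixes c g h :: "'s::comm_ring_1"
  assumes "c dvd g - h" "c dvd g"
  shows "c dvd h"
  using dvd_diff[OF assms(2,1)] by simp

lemma inY_in_modY: "inY h \<in> modY c"
  by (auto simp: modY_def intro!: exI[of _ h])

lemma is_subalg_modY: "is_subalg (modY c)"
  unfolding is_subalg_def
proof (intro conjI allI ballI)
  show "CC r \<in> modY c" for r using inY_in_modY[of "[:r:]"] by simp
next
  fix g h assume "g \<in> modY c" "h \<in> modY c"
  then obtain g' h' where *: "CC c dvd g - inY g'" "CC c dvd h - inY h'"
    by (auto simp: modY_def)
  have "CC c dvd (g + h) - inY (g' + h')"
    unfolding hom_add[OF is_ring_hom_inY] using * by (rule dvd_diff_add)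
  then show "g + h \<in> modY c" by (auto simp: modY_def)
  have "CC c dvd g * h - inY (g' * h')"
    unfolding hom_mult[OF is_ring_hom_inY] using * by (rule CC_dvd_diff_mult)
  then show "g * h \<in> modY c" by (auto simp: modY_def)
qed

definition modY_affine :: "'a::comm_ring_1 \<Rightarrow> 'a bipoly set" where
  "modY_affine c = {g. \<exists>\<alpha> \<beta>. CC c dvd g - (inY \<alpha> * Xv + inY \<beta>)}"

lemma modY_affine_add:
  assumes "g \<in> modY_affine c" "h \<in> modY_affine c"
  shows "g + h \<in> modY_affine c"
proof -
  obtain \<alpha> \<beta> \<alpha>' \<beta>' where "CC c dvd g - (inY \<alpha> * Xv + inY \<beta>)" "CC c dvd h - (inY \<alpha>' * Xv + inY \<beta>')"
    using assms by (auto simp: modY_affine_def)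
  from dvd_diff_add[OF this] have "CC c dvd (g + h) - (inY (\<alpha> + \<alpha>') * Xv + inY (\<beta> + \<beta>'))"
    by (simp add: hom_add[OF is_ring_hom_inY] algebra_simps)
  then show ?thesis by (auto simp: modY_affine_def)
qed

lemma modY_affine_mult:
  assumes "g \<in> modY c" "h \<in> modY_affine c"
  shows "g * h \<in> modY_affine c"
proof -
  obtain \<alpha> \<beta> k where "CC c dvd g - inY k" "CC c dvd h - (inY \<alpha> * Xv + inY \<beta>)"
    using assms by (auto simp: modY_affine_def modY_def)
  from CC_dvd_diff_mult[OF this] have "CC c dvd g * h - (inY (k * \<alpha>) * Xv + inY (k * \<beta>))"
    by (simp add: hom_mult[OF is_ring_hom_inY] algebra_simps)
  then show ?thesis by (auto simp: modY_affine_def)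
qed

lemma modY_affine_Xv: "Xv \<in> modY_affine c"
proof -
  have "CC c dvd Xv - (inY 1 * Xv + inY 0)" by (simp add: hom_one[OF is_ring_hom_inY])
  then show ?thesis unfolding modY_affine_def by blast
qed

lemma modY_affine_modY:
  assumes "g \<in> modY c"
  shows "g \<in> modY_affine c"
proof -
  obtain h where "CC c dvd g - (inY 0 * Xv + inY h)" using assms by (auto simp: modY_def)
  then show ?thesis unfolding modY_affine_def by blast
qed

lemma modY_affine_dvd:
  assumes "CC c dvd g"
  shows "g \<in> modY_affine c"
proof -
  have "CC c dvd g - (inY 0 * Xv + inY 0)" using assms by simp
  then show ?thesis unfolding modY_affine_def by blast
qed

lemma modY_affine_diff:
  assumes "g \<in> modY_affine c" "h \<in> modY_affine c"
  shows "g - h \<in> modY_affine c"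
proof -
  have "g - h = g + CC (-1) * h" by simp
  then show ?thesis
    using modY_affine_add[OF assms(1) modY_affine_mult[OF subalg_CC[OF is_subalg_modY] assms(2)]]
    by metis
qed

text \<open>First-order expansion in \<open>c\<close>: the coefficient of \<open>c\<close> stays affine in \<open>x\<close> modulo \<open>c\<close>.\<close>

lemma eval2_modY_affine:
  assumes "u = inY h + CC c * m" "m \<in> modY_affine c" "v = inY k + CC c * n" "n \<in> modY_affine c"
  shows "\<exists>l\<in>modY_affine c. eval2 g u v = eval2 g (inY h) (inY k) + CC c * l"
proof -
  \<comment> \<open>The pairs keep both values in step during the induction and record that the base
    value is a polynomial in y.\<close>
  define T where "T = {(z, w). \<exists>e. w = inY e \<and> (\<exists>l\<in>modY_affine c. z = w + CC c * l)}"
  have "(eval2 g u v, eval2 g (inY h) (inY k)) \<in> T"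
  proof (induction g rule: bipoly_induct)
    case (const r)
    show ?case
      using modY_affine_dvd[of c 0] by (auto simp: T_def intro!: exI[of _ "[:r:]"] bexI[of _ 0])
  next
    case X
    show ?case using assms by (auto simp: T_def)
  next
    case Y
    show ?case using assms by (auto simp: T_def)
  next
    case (add g h')
    then obtain e l e' l' where
      "l \<in> modY_affine c" "l' \<in> modY_affine c" "eval2 g u v = inY e + CC c * l"
      "eval2 h' u v = inY e' + CC c * l'" "eval2 g (inY h) (inY k) = inY e"
      "eval2 h' (inY h) (inY k) = inY e'"
      by (auto simp: T_def)
    then show ?case
      by (auto simp: T_def eval2_hom hom_add[OF is_ring_hom_inY] algebra_simps
          intro!: exI[of _ "e + e'"] bexI[of _ "l + l'"] modY_affine_add)
  next
    case (mult g h')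
    then obtain e l e' l' where *:
      "l \<in> modY_affine c" "l' \<in> modY_affine c" "eval2 g u v = inY e + CC c * l"
      "eval2 h' u v = inY e' + CC c * l'" "eval2 g (inY h) (inY k) = inY e"
      "eval2 h' (inY h) (inY k) = inY e'"
      by (auto simp: T_def)
    \<comment> \<open>The product \<open>l * l'\<close> may be quadratic in x, but it comes with a
      factor \<open>c\<close> and vanishes modulo \<open>c\<close>.\<close>
    have "inY e * l' + inY e' * l + CC c * (l * l') \<in> modY_affine c"
      using * modY_affine_add modY_affine_mult[OF inY_in_modY]
        modY_affine_dvd[OF dvd_triv_left] by metis
    then show ?case using *
      by (auto simp: T_def eval2_hom hom_mult[OF is_ring_hom_inY] algebra_simps
          intro!: exI[of _ "e * e'"] bexI[of _ "inY e * l' + inY e' * l + CC c * (l * l')"])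
  qed
  then show ?thesis by (auto simp: T_def)
qed


section \<open>The generators of the invariant ring\<close>

lemma coeff_pcompose_monom:
  fixes h :: "'s::comm_ring_1 poly"
  assumes "m > 0"
  shows "coeff (pcompose h (monom 1 m)) n = (if m dvd n then coeff h (n div m) else 0)"
proof (induction h arbitrary: n)
  case (pCons c h)
  consider "n = 0" | "0 < n" "n < m" | k where "n = m + k"
    by (metis le_Suc_ex not_less gr0I)
  then show ?case
  proof cases
    case 2
    then show ?thesis
      by (auto simp: pcompose_pCons coeff_monom_mult coeff_pCons dest: dvd_imp_le split: nat.splits)
  next
    case 3
    then show ?thesis using assms
      by (auto simp: pcompose_pCons coeff_monom_mult coeff_pCons pCons.IH split: nat.splits)
  qed (use assms in \<open>simp add: pcompose_pCons coeff_monom_mult\<close>)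
qed simp

lemma frobenius_pcompose:
  fixes h :: "'s::comm_ring_1 poly"
  assumes "prime CHAR('s)"
  shows "pcompose (map_poly (\<lambda>c. c ^ CHAR('s)) h) (monom 1 CHAR('s)) = h ^ CHAR('s)"
proof (induction h)
  case 0
  show ?case using prime_gt_0_nat[OF assms] by (simp add: power_0_left)
next
  case (pCons c h)
  have z: "(0::'s) ^ CHAR('s) = 0" using prime_gt_0_nat[OF assms] by (simp add: power_0_left)
  have "([:c:] + [:0, 1:] * h) ^ CHAR('s) = [:c:] ^ CHAR('s) + ([:0, 1:] * h) ^ CHAR('s)"
    by (rule freshmans_dream) (use assms in simp_all)
  then have "pCons c h ^ CHAR('s) = [:c ^ CHAR('s):] + monom 1 CHAR('s) * h ^ CHAR('s)"
    unfolding poly_const_pow power_mult_distrib monom_altdef by simp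
  then show ?case
    unfolding map_poly_pCons[of "\<lambda>c. c ^ CHAR('s)", OF z] pcompose_pCons pCons.IH by simp
qed

text \<open>The exponents brought down by differentiation are integers, which the p-th power map
  fixes.\<close>

lemma pderiv_frobenius:
  fixes h :: "'s::idom poly"
  assumes "prime CHAR('s)"
  shows "pderiv (map_poly (\<lambda>c. c ^ CHAR('s)) h) = map_poly (\<lambda>c. c ^ CHAR('s)) (pderiv h)"
  using prime_gt_0_nat[OF assms]
  by (intro poly_eqI)
     (simp add: coeff_pderiv coeff_map_poly power_0_left power_mult_distrib
       of_nat_power_CHAR[OF assms] del: of_nat_Suc)

section \<open>The Nagata data and the constants \<open>d\<close>, \<open>b\<close>,
  \<open>\<rho>\<close>\<close>

locale nagata =
  fixes a :: "'a::{factorial_ring_gcd, semiring_gcd_mult_normalize}"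
    and \<theta> :: "'a poly" and Fp :: "'a poly" and lam :: "'a bipoly"
  assumes char_pos: "CHAR('a) > 0"
    and a_nz: "a \<noteq> 0"
    and F_nz: "nag_F a \<theta> Fp \<noteq> 0"
    and lam: "inY (pderiv (nag_rho a \<theta>)) ^ CHAR('a) * Yv =
      eval2 lam (Yv ^ CHAR('a)) (inY (nag_rho a \<theta>))"
begin

abbreviation "f \<equiv> nag_f a \<theta>"
abbreviation "F \<equiv> nag_F a \<theta> Fp"
abbreviation "\<phi> \<equiv> nag_phi a \<theta> Fp"
abbreviation "u \<equiv> CC a * F"
abbreviation "d \<equiv> nag_d a \<theta>"
abbreviation "b \<equiv> nag_b a \<theta>"
abbreviation "\<rho> \<equiv> nag_rho a \<theta>"
abbreviation "\<rho>p \<equiv> nag_rho_p a \<theta>"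
abbreviation "\<theta>s \<equiv> nag_theta_star \<theta>"
abbreviation "q \<equiv> nag_q a \<theta> Fp"
abbreviation "q1 \<equiv> nag_q1 a \<theta> Fp"
abbreviation "q1t \<equiv> nag_q1t a \<theta> Fp"
abbreviation "q2 \<equiv> nag_q2 a \<theta> Fp lam"

lemma prime_p: "prime CHAR('a)"
  by (rule prime_CHAR_semidom[OF char_pos])

lemma p_ge_2: "CHAR('a) \<ge> 2"
  by (rule prime_ge_2_nat[OF prime_p])

text \<open>A divisor of the nonzero constant \<open>a\<close> has degree 0, so taking coefficient 0
  in \<open>nag_d\<close> loses nothing.\<close>

lemma gcd_eq: "gcd [:a:] (pderiv \<theta>) = [:d:]"
proof -
  have "degree (gcd [:a:] (pderiv \<theta>)) \<le> degree [:a:]"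
    by (rule dvd_imp_degree_le) (use a_nz in simp_all)
  then have "degree (gcd [:a:] (pderiv \<theta>)) = 0" by simp
  then show ?thesis unfolding nag_d_def by (metis degree_0_id)
qed

lemma d_dvd_a: "d dvd a"
  using gcd_dvd1[of "[:a:]" "pderiv \<theta>"] unfolding gcd_eq by simp

lemma d_nz: "d \<noteq> 0"
  using d_dvd_a a_nz by auto

lemma a_eq: "a = b * d"
  using d_dvd_a by (simp add: nag_b_def)

lemma b_nz: "b \<noteq> 0"
  using a_eq a_nz by auto

text \<open>\<open>d\<close> divides \<open>i\<close> times the coefficient, and \<open>i\<close> is
  invertible because p does not divide it.\<close>

lemma d_dvd_coeff:
  assumes "\<not> CHAR('a) dvd i"
  shows "d dvd coeff \<theta> i"
proof -
  obtain n where i: "i = Suc n" using assms by (cases i) auto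
  have "[:d:] dvd pderiv \<theta>"
    using gcd_dvd2[of "[:a:]" "pderiv \<theta>"] unfolding gcd_eq .
  then have "d dvd of_nat i * coeff \<theta> i"
    unfolding const_poly_dvd_iff coeff_pderiv i by blast
  then show ?thesis using dvd_of_nat_mult_cancel[OF prime_p assms] by blast
qed

lemma coeff_rho: "coeff \<rho> i = (if CHAR('a) dvd i then 0 else coeff \<theta> i div d)"
proof -
  have "coeff \<rho> i = (\<Sum>j\<le>degree \<theta>.
      if j = i then (if CHAR('a) dvd i then 0 else coeff \<theta> i div d) else 0)"
    unfolding nag_rho_def coeff_sum by (intro sum.cong) auto
  then show ?thesis by (auto simp: coeff_eq_0)
qed

lemma d_coeff_rho: "\<not> CHAR('a) dvd i \<Longrightarrow> d * coeff \<rho> i = coeff \<theta> i"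
  using d_dvd_coeff by (simp add: coeff_rho)

lemma rho_p_eq: "\<rho>p = map_poly (\<lambda>c. c ^ CHAR('a)) \<rho>"
proof (rule poly_eqI)
  fix i
  have "coeff \<rho>p i = (\<Sum>j\<le>degree \<theta>.
      if j = i then (if CHAR('a) dvd i then 0 else (coeff \<theta> i div d) ^ CHAR('a)) else 0)"
    unfolding nag_rho_p_def coeff_sum by (intro sum.cong) auto
  then show "coeff \<rho>p i = coeff (map_poly (\<lambda>c. c ^ CHAR('a)) \<rho>) i"
    using char_pos by (auto simp: coeff_eq_0 coeff_map_poly coeff_rho power_0_left)
qed

lemma coeff_theta_star: "coeff \<theta>s i = coeff \<theta> (CHAR('a) * i)"
proof -
  have "coeff \<theta>s i = (\<Sum>j\<le>degree \<theta>. if j = i then coeff \<theta> (CHAR('a) * i) else 0)"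
    unfolding nag_theta_star_def coeff_sum by (intro sum.cong) auto
  moreover have "coeff \<theta> (CHAR('a) * i) = 0" if "\<not> i \<le> degree \<theta>"
    using that mult_le_mono1[of 1 "CHAR('a)" i] char_pos by (intro coeff_eq_0) linarith
  ultimately show ?thesis by auto
qed

lemma theta_eq: "\<theta> = pcompose \<theta>s (monom 1 CHAR('a)) + smult d \<rho>"
proof (rule poly_eqI)
  fix i
  show "coeff \<theta> i = coeff (pcompose \<theta>s (monom 1 CHAR('a)) + smult d \<rho>) i"
    using d_coeff_rho[of i]
    by (simp add: coeff_pcompose_monom[OF char_pos] coeff_theta_star) (simp add: coeff_rho)
qed

lemma pderiv_theta: "pderiv \<theta> = smult d (pderiv \<rho>)"
proof (rule poly_eqI)
  fix n
  show "coeff (pderiv \<theta>) n = coeff (smult d (pderiv \<rho>)) n"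
  proof (cases "CHAR('a) dvd Suc n")
    case True
    then have "(of_nat (Suc n) :: 'a) = 0" by (simp only: of_nat_eq_0_iff_char_dvd)
    then show ?thesis by (simp add: coeff_pderiv del: of_nat_Suc)
  next
    case False
    then show ?thesis using d_coeff_rho[OF False]
      by (simp add: coeff_pderiv mult.left_commute[of d] del: of_nat_Suc)
  qed
qed

text \<open>Otherwise \<open>d * c\<close> would divide both \<open>a = b * d\<close> and
  \<open>pderiv \<theta>\<close>, whose gcd is \<open>d\<close>.\<close>

lemma prime_not_dvd_pderiv_rho:
  assumes "prime_elem c" "c dvd b"
  shows "\<not> [:c:] dvd pderiv \<rho>"
proof
  assume "[:c:] dvd pderiv \<rho>"
  then have "[:d * c:] dvd pderiv \<theta>"
    unfolding pderiv_theta by (auto simp: const_poly_dvd_iff)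
  moreover have "[:d * c:] dvd [:a:]"
    using mult_dvd_mono[OF assms(2) dvd_refl[of d]] a_eq by (simp add: mult.commute)
  ultimately have "[:d * c:] dvd [:d:]" unfolding gcd_eq[symmetric] by (rule gcd_greatest[rotated])
  then have "c dvd 1" using d_nz by simp
  with assms(1) show False by (simp add: prime_elem_def)
qed

lemma CC_a: "CC a = CC b * CC d"
  by (metis a_eq CC_mult)

lemma monom_Yv: "evalY (monom 1 n) Yv = Yv ^ n"
  by (simp add: monom_altdef hom_power[OF is_ring_hom_evalY] evalY_pCons)

lemma evalY_Yp: "evalY h (Yv ^ CHAR('a)) = inY (pcompose h (monom 1 CHAR('a)))"
  by (simp add: inY_eq_evalY evalY_pcompose monom_Yv)

lemma Yp_eq: "(Yv :: 'a bipoly) ^ CHAR('a) = inY (monom 1 CHAR('a))"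
  by (simp add: inY_eq_evalY monom_Yv)

section \<open>Expansions of \<open>q1\<close> and \<open>q2\<close> around polynomials in y\<close>

lemma modY_a:
  assumes "c dvd a"
  shows "f \<in> modY c" "F \<in> modY c" "Yv \<in> modY c" "u \<in> modY c" "q \<in> modY c"
proof -
  note S = is_subalg_modY[of c]
  have "CC c dvd CC a" using assms by (simp add: CC_def)
  then show f: "f \<in> modY c" unfolding modY_def nag_f_def by (auto intro!: exI[of _ \<theta>])
  then show F: "F \<in> modY c" unfolding nag_F_def by (rule subalg_evalY[OF S])
  have "inY [:0, 1:] \<in> modY c" by (rule inY_in_modY)
  then show Y: "Yv \<in> modY c" by (simp add: inY_eq_evalY evalY_pCons)
  show "u \<in> modY c" using F S by (auto intro: subalg_intros)
  then show "q \<in> modY c" unfolding nag_q_def using S Y by (auto intro: subalg_intros)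
qed

text \<open>The division by \<open>d\<close> in \<open>nag_q1\<close> is exact: besides a x and
  \<open>d\<close> times \<open>\<rho>\<close>, the numerator contains only the difference of
  \<open>\<theta>s\<close> at y^p and at \<open>q\<close>, which is divisible by \<open>u\<close>
  and hence by \<open>a = b * d\<close>.\<close>

lemma q1_expand:
  shows "CC d * q1 = f - evalY \<theta>s q"
    and "\<exists>E\<in>modY a. q1 = inY \<rho> + CC b * (Xv + E)"
proof -
  \<comment> \<open>With p - 1 equal to \<open>Suc n\<close>, one factor \<open>u\<close> can be
    split off from its power in \<open>q\<close>.\<close>
  obtain n where n: "CHAR('a) = Suc (Suc n)"
    using p_ge_2 by (metis add_2_eq_Suc le_add_diff_inverse numeral_2_eq_2)
  note S = is_subalg_modY[of a] and M = modY_a[OF dvd_refl]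
  have "Yv ^ CHAR('a) \<in> modY a" using S M by (auto intro: subalg_intros)
  then obtain G where G: "G \<in> modY a" "evalY \<theta>s (Yv ^ CHAR('a)) - evalY \<theta>s q = (Yv ^ CHAR('a) - q) * G"
    using evalY_diff_factor[OF S] M by metis
  have Yq: "Yv ^ CHAR('a) - q = u * u ^ n * Yv" by (simp add: nag_q_def n)
  have th: "inY \<theta> = evalY \<theta>s (Yv ^ CHAR('a)) + CC d * inY \<rho>"
    by (subst theta_eq) (simp add: hom_add[OF is_ring_hom_inY] evalY_Yp flip: hom_mult[OF is_ring_hom_inY] inY_const)
  define E where "E = F * u ^ n * Yv * G"
  have E: "E \<in> modY a" unfolding E_def using G(1) M S by (auto intro: subalg_intros)
  have "f - evalY \<theta>s q = CC a * Xv + CC d * inY \<rho> + (evalY \<theta>s (Yv ^ CHAR('a)) - evalY \<theta>s q)"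
    by (simp add: nag_f_def th)
  also have "\<dots> = CC d * (inY \<rho> + CC b * (Xv + E))"
    unfolding G(2) Yq E_def by (simp add: CC_a algebra_simps)
  finally have *: "f - evalY \<theta>s q = CC d * (inY \<rho> + CC b * (Xv + E))" .
  then have q1: "q1 = inY \<rho> + CC b * (Xv + E)"
    by (simp add: nag_q1_def d_nz)
  with * show "CC d * q1 = f - evalY \<theta>s q" by simp
  from q1 E show "\<exists>E\<in>modY a. q1 = inY \<rho> + CC b * (Xv + E)" by blast
qed

text \<open>Both divisions are exact. The linear Taylor term of \<open>\<rho>p\<close> at y^p is a
  multiple of \<open>lam\<close> at (y^p, \<open>\<rho>\<close>), and passing to (\<open>q\<close>,
  \<open>q1\<close>) costs only a multiple of \<open>b\<close>. What remains is x^p plus terms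
  affine in x modulo \<open>b\<close>.\<close>

lemma q2_expand:
  shows "CC b ^ (CHAR('a) - 1) * q1t = q1 ^ CHAR('a) - evalY \<rho>p q"
    and "CC b * q2 = q1t - eval2 lam q q1 * (CC d * F) ^ (CHAR('a) - 1)"
    and "q2 - Xv ^ CHAR('a) \<in> modY_affine b"
proof -
  obtain n where n: "CHAR('a) = Suc (Suc n)"
    using p_ge_2 by (metis add_2_eq_Suc le_add_diff_inverse numeral_2_eq_2)
  have "b dvd a" using a_eq by (metis dvd_triv_left)
  note S = is_subalg_modY[of b] and M = modY_a[OF \<open>b dvd a\<close>]
  obtain E where E: "E \<in> modY a" and q1: "q1 = inY \<rho> + CC b * (Xv + E)"
    using q1_expand(2) by blast
  have "CC b dvd CC a" by (simp add: CC_a)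
  with E have E: "E \<in> modY b" unfolding modY_def using dvd_trans by blast
  have Yp: "Yv ^ CHAR('a) \<in> modY b" using S M by (auto intro: subalg_intros)
  obtain W where W: "W \<in> modY b" "evalY \<rho>p (Yv ^ CHAR('a)) - evalY \<rho>p q =
      (Yv ^ CHAR('a) - q) * evalY (pderiv \<rho>p) (Yv ^ CHAR('a)) + (Yv ^ CHAR('a) - q)\<^sup>2 * W"
    using evalY_taylor[OF S Yp M(5)] by blast
  have Yq: "Yv ^ CHAR('a) - q = u * u ^ n * Yv" by (simp add: nag_q_def n)
  have d1: "evalY \<rho>p (Yv ^ CHAR('a)) = inY \<rho> ^ CHAR('a)"
    by (simp add: evalY_Yp rho_p_eq frobenius_pcompose[OF prime_p] hom_power[OF is_ring_hom_inY])
  have "evalY (pderiv \<rho>p) (Yv ^ CHAR('a)) = inY (pderiv \<rho>) ^ CHAR('a)"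
    by (simp add: evalY_Yp rho_p_eq frobenius_pcompose[OF prime_p] pderiv_frobenius[OF prime_p]
        hom_power[OF is_ring_hom_inY])
  then have d2: "evalY (pderiv \<rho>p) (Yv ^ CHAR('a)) * Yv = eval2 lam (Yv ^ CHAR('a)) (inY \<rho>)"
    using lam by simp
  let ?L = "eval2 lam (Yv ^ CHAR('a)) (inY \<rho>)"
  have fr: "(g + h) ^ CHAR('a) = g ^ CHAR('a) + h ^ CHAR('a)" for g h :: "'a bipoly"
    by (rule freshmans_dream) (simp_all add: prime_p)
  have "q1 ^ CHAR('a) - evalY \<rho>p q = (evalY \<rho>p (Yv ^ CHAR('a)) - evalY \<rho>p q)
      + CC b ^ CHAR('a) * (Xv ^ CHAR('a) + E ^ CHAR('a))"
    unfolding q1 fr power_mult_distrib d1 by simp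
  also have "\<dots> = u * u ^ n * ?L + (u * u ^ n * Yv)\<^sup>2 * W
      + CC b ^ CHAR('a) * (Xv ^ CHAR('a) + E ^ CHAR('a))"
    unfolding W(2) Yq d2[symmetric] by (simp add: algebra_simps)
  \<comment> \<open>As \<open>u\<close> is b d F, each Taylor term contains b^(p-1); the quadratic
    one keeps a further \<open>u * u ^ n\<close>, divisible by \<open>b\<close>.\<close>
  also have "\<dots> = CC b ^ (CHAR('a) - 1) * (CC b * (Xv ^ CHAR('a) + E ^ CHAR('a))
      + (CC d * F) ^ (CHAR('a) - 1) * ?L
      + (CC d * F) ^ (CHAR('a) - 1) * (u * u ^ n) * Yv\<^sup>2 * W)"
    by (simp add: n CC_a power_mult_distrib power2_eq_square algebra_simps)
  finally have *: "q1 ^ CHAR('a) - evalY \<rho>p q = \<dots>" .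
  then have q1t: "q1t = CC b * (Xv ^ CHAR('a) + E ^ CHAR('a))
      + (CC d * F) ^ (CHAR('a) - 1) * ?L
      + (CC d * F) ^ (CHAR('a) - 1) * (u * u ^ n) * Yv\<^sup>2 * W"
    by (simp add: nag_q1t_def CC_power b_nz)
  with * show "CC b ^ (CHAR('a) - 1) * q1t = q1 ^ CHAR('a) - evalY \<rho>p q" by simp
  have "q = inY (monom 1 CHAR('a)) + CC b * (- (CC d * F * u ^ n * Yv))"
    unfolding Yp_eq[symmetric] by (simp add: nag_q_def n CC_a algebra_simps)
  moreover have "- (CC d * F * u ^ n * Yv) \<in> modY_affine b"
  proof -
    have "CC (-1) * (CC d * F * u ^ n * Yv) \<in> modY b" using S M by (intro subalg_intros) auto
    then show ?thesis using modY_affine_modY by fastforce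
  qed
  moreover have XE: "Xv + E \<in> modY_affine b"
    by (intro modY_affine_add modY_affine_Xv modY_affine_modY E)
  \<comment> \<open>\<open>q\<close> and \<open>q1\<close> differ from y^p and \<open>\<rho>\<close>
    by \<open>b\<close> times terms affine in x, hence so do the values of
    \<open>lam\<close>.\<close>
  ultimately obtain l where l: "l \<in> modY_affine b" "eval2 lam q q1 = ?L + CC b * l"
    using eval2_modY_affine[OF _ _ q1 XE] Yp_eq by metis
  have **: "q1t - eval2 lam q q1 * (CC d * F) ^ (CHAR('a) - 1) = CC b * (Xv ^ CHAR('a) + E ^ CHAR('a)
      + (CC d * F) ^ CHAR('a) * u ^ n * Yv\<^sup>2 * W - (CC d * F) ^ (CHAR('a) - 1) * l)" (is "_ = CC b * ?Z")
    unfolding q1t l(2) by (simp add: n CC_a algebra_simps)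
  then have q2: "q2 = ?Z" by (simp add: nag_q2_def b_nz)
  with ** show "CC b * q2 = q1t - eval2 lam q q1 * (CC d * F) ^ (CHAR('a) - 1)" by simp
  have "q2 - Xv ^ CHAR('a) = (E ^ CHAR('a) + (CC d * F) ^ CHAR('a) * u ^ n * Yv\<^sup>2 * W)
      - (CC d * F) ^ (CHAR('a) - 1) * l"
    unfolding q2 by simp
  also have "\<dots> \<in> modY_affine b"
  proof (rule modY_affine_diff[OF modY_affine_modY modY_affine_mult[OF _ l(1)]])
    show "E ^ CHAR('a) + (CC d * F) ^ CHAR('a) * u ^ n * Yv\<^sup>2 * W \<in> modY b"
      using S M E W(1) by (auto intro!: subalg_intros)
    show "(CC d * F) ^ (CHAR('a) - 1) \<in> modY b"
      using S M by (auto intro!: subalg_intros)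
  qed
  finally show "q2 - Xv ^ CHAR('a) \<in> modY_affine b" .
qed

section \<open>Invariance of the generators\<close>

lemma is_ring_hom_phi: "is_ring_hom \<phi>"
  by (simp add: is_ring_hom_def nag_phi_def eval2_hom hom_one[OF is_ring_hom_eval2])

lemmas phi_hom = hom_add[OF is_ring_hom_phi] hom_mult[OF is_ring_hom_phi]
  hom_power[OF is_ring_hom_phi] hom_diff[OF is_ring_hom_phi]

lemma phi_CC: "\<phi> (CC r) = CC r"
  by (simp add: nag_phi_def)

lemma phi_Yv: "\<phi> Yv = Yv + u"
  by (simp add: nag_phi_def)

lemma phi_evalY: "\<phi> (evalY h g) = evalY h (\<phi> g)"
  by (simp add: nag_phi_def eval2_evalY)

text \<open>The quotient by \<open>a\<close> in \<open>nag_phi\<close> is exact because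
  \<open>u\<close> divides the change of \<open>\<theta>\<close>; the changes of a x and of
  \<open>\<theta>\<close> then offset each other.\<close>

lemma phi_f: "\<phi> f = f"
proof -
  let ?D = "inY \<theta> - evalY \<theta> (Yv + u)"
  have "is_subalg (UNIV :: 'a bipoly set)" by (simp add: is_subalg_def)
  then obtain G where "?D = (Yv - (Yv + u)) * G"
    using evalY_diff_factor[of UNIV Yv "Yv + u" \<theta>] by (auto simp: inY_eq_evalY)
  then have "?D = CC a * (- F * G)" by (simp add: algebra_simps)
  then have D: "CC a * (?D div CC a) = ?D" by simp
  have X: "\<phi> Xv = Xv + ?D div CC a" by (simp add: nag_phi_def)
  have "\<phi> f = CC a * \<phi> Xv + evalY \<theta> (Yv + u)"
    by (simp add: nag_f_def phi_hom phi_CC inY_eq_evalY phi_evalY phi_Yv)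
  also have "\<dots> = f"
    unfolding X distrib_left D by (simp add: nag_f_def)
  finally show ?thesis .
qed

lemma phi_F: "\<phi> F = F"
  by (simp add: nag_F_def phi_evalY phi_f)

lemma phi_q: "\<phi> q = q"
proof -
  have "(Yv + u) ^ CHAR('a) = Yv ^ CHAR('a) + u ^ CHAR('a)"
    by (rule freshmans_dream) (simp_all add: prime_p)
  moreover have "u ^ (CHAR('a) - 1) * u = u ^ CHAR('a)" using char_pos by (rule power_minus_mult)
  ultimately show ?thesis
    by (simp add: nag_q_def phi_hom phi_CC phi_F phi_Yv distrib_left)
qed

text \<open>Reduces the invariance of an exact quotient to that of its numerator.\<close>

lemma phi_cancel:
  assumes "c \<noteq> 0" "\<phi> (CC c * g) = CC c * g"
  shows "\<phi> g = g"
  using assms by (simp add: phi_hom phi_CC)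

lemma phi_eval2: "\<phi> (eval2 P g h) = eval2 P (\<phi> g) (\<phi> h)"
  by (simp add: nag_phi_def eval2_eval2)

lemma phi_q1: "\<phi> q1 = q1"
  by (rule phi_cancel[OF d_nz]) (simp add: q1_expand(1) phi_hom phi_f phi_evalY phi_q)

lemma phi_q2: "\<phi> q2 = q2"
proof -
  have "b ^ (CHAR('a) - 1) \<noteq> 0" using b_nz by simp
  then have *: "\<phi> q1t = q1t"
    by (rule phi_cancel) (simp only: CC_power q2_expand(1) phi_hom phi_evalY phi_q phi_q1)
  show ?thesis
    by (rule phi_cancel[OF b_nz])
       (simp add: q2_expand(2) phi_hom phi_eval2 phi_q phi_q1 phi_CC phi_F *)
qed

lemma subalg_invariant:
  assumes "g \<in> subalg {q, q1, q2}"
  shows "\<phi> g = g"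
  using assms
  by induction (auto simp: phi_CC phi_q phi_q1 phi_q2 phi_hom)

section \<open>Saturation of the generated subalgebra\<close>

lemma dvd_swap_q_diff:
  assumes "c dvd a"
  shows "CC c dvd swap q - [:monom 1 CHAR('a):]"
proof -
  have "CC c dvd CC a" using assms by (simp add: CC_def)
  then have "CC c dvd u" by (rule dvd_mult2)
  also have "u dvd u ^ (CHAR('a) - 1)" using p_ge_2 by (intro dvd_power) simp
  finally have "CC c dvd CC (-1) * Yv * u ^ (CHAR('a) - 1)" by (rule dvd_mult)
  also have "CC (-1) * Yv * u ^ (CHAR('a) - 1) = q - inY (monom 1 CHAR('a))"
    by (simp add: nag_q_def flip: Yp_eq)
  finally have "CC c dvd swap (q - inY (monom 1 CHAR('a)))" by (simp only: CC_dvd_swap_iff)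
  then show ?thesis by (simp add: swap_hom)
qed

text \<open>Modulo \<open>c\<close>, \<open>q1\<close> is b x + s(y), of degree one in x with
  leading coefficient prime to \<open>c\<close>, and \<open>q\<close> is y^p. Using
  \<open>const_dvd_pcompose\<close> for x and then on each coefficient shows that they are
  independent.\<close>

lemma prime_const_dvd_eval2:
  assumes "prime_elem c" "c dvd a" "\<not> c dvd b" "CC c dvd eval2 P q q1"
  shows "CC c dvd P"
proof -
  obtain E where E: "E \<in> modY a" and q1: "q1 = inY \<rho> + CC b * (Xv + E)"
    using q1_expand(2) by blast
  have ca: "CC c dvd CC a" using assms(2) by (simp add: CC_def)
  obtain e where "CC a dvd E - inY e" using E by (auto simp: modY_def)
  with ca have e: "CC c dvd E - inY e" by (rule dvd_trans)
  \<comment> \<open>\<open>E\<close> reduces to \<open>e\<close> modulo \<open>c\<close>, so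
    \<open>s\<close> is the part of \<open>q1\<close> free of x.\<close>
  define s where "s = \<rho> + smult b e"
  have "inY s = inY \<rho> + CC b * inY e"
    by (simp add: s_def hom_add[OF is_ring_hom_inY] flip: hom_mult[OF is_ring_hom_inY] inY_const)
  then have "q1 - (CC b * Xv + inY s) = CC b * (E - inY e)"
    by (simp add: q1 algebra_simps)
  then have "CC c dvd q1 - (CC b * Xv + inY s)" using e by simp
  then have d1: "CC c dvd swap q1 - (CC b * Yv + [:s:])"
    using hom_dvd[OF is_ring_hom_swap, of "CC c"] by (fastforce simp: swap_hom)
  note d2 = dvd_swap_q_diff[OF assms(2)]
  let ?Q = "CC b * Yv + [:s:]"
  have Q: "?Q = [:s, [:b:]:]" by (simp add: CC_def Yv_def)
  have "CC c dvd swap (eval2 P q q1)" using assms(4) by (simp add: CC_dvd_swap_iff)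
  then have "CC c dvd eval2 P [:monom 1 CHAR('a):] ?Q"
    unfolding swap_eval2 by (rule dvd_of_dvd_diff[OF eval2_dvd_diff[OF d2 d1]])
  then have "[:[:c:]:] dvd pcompose (map_poly (\<lambda>r. pcompose r (monom 1 CHAR('a))) P) ?Q"
    unfolding eval2_const_eq_pcompose CC_def .
  then have *: "[:[:c:]:] dvd map_poly (\<lambda>r. pcompose r (monom 1 CHAR('a))) P"
    by (rule const_dvd_pcompose[OF lift_prime_elem_poly[OF assms(1)], rotated 2])
       (use b_nz assms(3) in \<open>auto simp: Q\<close>)
  have "[:c:] dvd coeff P i" for i
  proof -
    have "[:c:] dvd pcompose (coeff P i) (monom 1 CHAR('a))"
      using * unfolding const_poly_dvd_iff[of "[:c:]"] by (simp add: coeff_map_poly)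
    then show ?thesis
      by (rule const_dvd_pcompose[OF assms(1), rotated 2])
         (use assms(1) char_pos in \<open>auto simp: degree_monom_eq prime_elem_def\<close>)
  qed
  then show ?thesis by (simp add: CC_dvd_iff)
qed

abbreviation "B \<equiv> subalg {q, q1, q2}"

lemma is_subalg_B: "is_subalg B"
  by (auto simp: is_subalg_def intro: subalg.intros)

lemma gens_in_B: "q \<in> B" "q1 \<in> B" "q2 \<in> B"
  by (auto intro: subalg.gen)

text \<open>\<open>q2\<close> is made the outermost variable because, modulo primes of
  \<open>b\<close>, it alone involves x and is eliminated first.\<close>

lemma B_as_poly_q2:
  assumes "w \<in> B"
  shows "\<exists>W. w = poly (map_poly (\<lambda>P. eval2 P q q1) W) q2"
proof -
  let ?h = "\<lambda>W. poly (map_poly (\<lambda>P. eval2 P q q1) W) q2"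
  have hom: "is_ring_hom ?h" by (rule is_ring_hom_eval[OF is_ring_hom_eval2])
  have c: "?h [:P:] = eval2 P q q1" for P
    by (simp add: hom_eval_pCons[OF is_ring_hom_eval2])
  show ?thesis using assms
  proof induction
    case (const r)
    then show ?case using c[of "CC r"] by (metis eval2_CC)
  next
    case (gen g)
    have "?h [:0, 1:] = q2"
      by (simp add: hom_eval_pCons[OF is_ring_hom_eval2] hom_one[OF is_ring_hom_eval2])
    then show ?case using gen c[of Xv] c[of Yv] unfolding eval2_Xv eval2_Yv by (metis empty_iff insert_iff)
  next
    case (add g h)
    then show ?case by (metis hom_add[OF hom])
  next
    case (mult g h)
    then show ?case by (metis hom_mult[OF hom])
  qed
qed

text \<open>The kernel of \<open>(X, Y) \<mapsto> (y\<^sup>p, \<rho>(y))\<close> modulo \<open>c\<close> is generated by \<open>Y\<^sup>p - \<rho>\<^sup>p(X)\<close>, whose value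
  at \<open>(q, q\<^sub>1)\<close> is a multiple of \<open>b\<close>, hence of \<open>c\<close>, inside the subalgebra.\<close>

lemma eval2_in_prime_multiple:
  assumes "prime_elem c" "c dvd b"
    and "[:c:] dvd poly (map_poly (\<lambda>r. pcompose r (monom 1 CHAR('a))) P) \<rho>"
  shows "\<exists>v\<in>B. eval2 P q q1 = CC c * v"
proof -
  let ?h = "\<lambda>P. poly (map_poly (\<lambda>r. pcompose r (monom 1 CHAR('a))) P) \<rho>"
  have hom: "is_ring_hom ?h" by (rule is_ring_hom_eval[OF is_ring_hom_pcompose])
  note S = is_subalg_B and G = gens_in_B
  define H where "H = monom 1 CHAR('a) - [:\<rho>p:]"
  have degH: "degree H = CHAR('a)"
  proof (rule antisym)
    show "degree H \<le> CHAR('a)" unfolding H_def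
      by (intro degree_diff_le order.trans[OF degree_monom_le]) auto
    show "CHAR('a) \<le> degree H"
      using p_ge_2 by (intro le_degree) (auto simp: H_def coeff_pCons split: nat.splits)
  qed
  then have lcH: "lead_coeff H = 1"
    using p_ge_2 by (auto simp: H_def coeff_pCons split: nat.splits)
  have H: "H = Yv ^ CHAR('a) - [:\<rho>p:]"
    by (simp add: H_def Yv_def monom_altdef)
  have "?h Yv = \<rho>" "?h [:\<rho>p:] = \<rho> ^ CHAR('a)"
    using frobenius_pcompose[OF prime_p, of \<rho>]
    by (simp_all add: Yv_def hom_eval_pCons[OF is_ring_hom_pcompose] pcompose_1 rho_p_eq)
  then have hH: "?h H = 0"
    unfolding H hom_diff[OF hom] hom_power[OF hom] by simp
  \<comment> \<open>Since \<open>H\<close> maps to 0, only the remainder matters, and its degree is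
    below p as \<open>const_dvd_eval_pcompose\<close> requires.\<close>
  obtain Q Rm where QR: "P = H * Q + Rm" "Rm = 0 \<or> degree Rm < degree H"
    using monic_division[OF lcH] .
  have "?h P = ?h Rm"
    unfolding QR(1) hom_add[OF hom] hom_mult[OF hom] hH by simp
  then have hR: "[:c:] dvd ?h Rm" using assms(3) by simp
  have "[:[:c:]:] dvd Rm"
  proof (rule const_dvd_eval_pcompose[OF assms(1) prime_p _ _ _ _ _ hR])
    show "\<not> [:c:] dvd pderiv \<rho>" by (rule prime_not_dvd_pderiv_rho[OF assms(1,2)])
    show "degree Rm < CHAR('a)" using QR(2) degH char_pos by auto
  qed (use assms(1) char_pos in \<open>auto simp: degree_monom_eq pderiv_monom prime_elem_def\<close>)
  then obtain R' where R': "Rm = CC c * R'" unfolding CC_def ..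
  obtain b' where b': "b = c * b'" using assms(2) ..
  have "eval2 H q q1 = q1 ^ CHAR('a) - evalY \<rho>p q"
    by (simp add: H eval2_hom)
  also have "\<dots> = CC b ^ (CHAR('a) - 1) * (CC b * q2 + eval2 lam q q1 * (CC d * F) ^ (CHAR('a) - 1))"
    unfolding q2_expand(1)[symmetric] q2_expand(2) by simp
  \<comment> \<open>As p is at least 2, there is at least one factor \<open>b\<close> from which
    \<open>c\<close> can be extracted.\<close>
  also have "CC b ^ (CHAR('a) - 1) = CC c * (CC b' * CC b ^ (CHAR('a) - 2))"
    using p_ge_2 by (simp add: b' CC_mult flip: power_Suc mult.assoc) (metis Suc_diff_le diff_Suc_Suc numeral_2_eq_2)
  finally have HB: "eval2 H q q1 = CC c * (CC b' * CC b ^ (CHAR('a) - 2) *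
      (CC b * q2 + eval2 lam q q1 * (CC d * F) ^ (CHAR('a) - 1)))" (is "_ = _ * ?V")
    by (simp only: mult.assoc)
  \<comment> \<open>This puts \<open>f\<close>, hence \<open>F\<close>, into \<open>B\<close>, so
    that the cofactor \<open>?V\<close> lies there as well.\<close>
  have "f = CC d * q1 + evalY \<theta>s q" by (simp add: q1_expand(1))
  then have "f \<in> B" using S G by (auto intro: subalg_intros subalg_evalY)
  then have F: "F \<in> B" unfolding nag_F_def using S by (rule subalg_evalY[rotated])
  have "?V \<in> B" using S G F by (intro subalg_intros subalg_eval2)
  with HB obtain V where V: "V \<in> B" "eval2 H q q1 = CC c * V" by blast
  have "eval2 P q q1 = CC c * (V * eval2 Q q q1 + eval2 R' q q1)"
    unfolding QR(1) R' eval2_hom eval2_CC V(2) by (simp only: mult.assoc distrib_left)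
  moreover have "V * eval2 Q q q1 + eval2 R' q q1 \<in> B"
    using S G V(1) by (intro subalg_intros subalg_eval2)
  ultimately show ?thesis by blast
qed

text \<open>Modulo \<open>c\<close>, \<open>q2\<close> is monic of degree p in x over the
  polynomials in y. So each coefficient of \<open>w\<close>, written as a polynomial in
  \<open>q2\<close>, vanishes modulo \<open>c\<close> at (y^p, \<open>\<rho>\<close>), and
  \<open>eval2_in_prime_multiple\<close> applies to it.\<close>

lemma prime_multiple_in_B:
  assumes "prime_elem c" "c dvd b" "w \<in> B" "CC c dvd w"
  shows "\<exists>v\<in>B. w = CC c * v"
proof -
  let ?Yp = "monom 1 CHAR('a)"
  let ?h = "\<lambda>P. poly (map_poly (\<lambda>r. pcompose r ?Yp) P) \<rho>"
  have hom: "is_ring_hom ?h" by (rule is_ring_hom_eval[OF is_ring_hom_pcompose])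
  have ca: "c dvd a" using assms(2) a_eq by (metis dvd_mult2)
  have cb: "CC c dvd CC b" using assms(2) by (simp add: CC_def)
  obtain \<alpha> \<beta> where "CC b dvd q2 - Xv ^ CHAR('a) - (inY \<alpha> * Xv + inY \<beta>)"
    using q2_expand(3) by (auto simp: modY_affine_def)
  with cb have "CC c dvd q2 - Xv ^ CHAR('a) - (inY \<alpha> * Xv + inY \<beta>)" by (rule dvd_trans)
  then have "CC c dvd swap (q2 - Xv ^ CHAR('a) - (inY \<alpha> * Xv + inY \<beta>))"
    by (simp only: CC_dvd_swap_iff)
  \<comment> \<open>The reduction of \<open>q2\<close> with x as the outer variable.\<close>
  moreover define Q where "Q = monom 1 CHAR('a) + [:\<beta>, \<alpha>:]"
  have "Q = Yv ^ CHAR('a) + ([:\<alpha>:] * Yv + [:\<beta>:])"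
    by (simp add: Q_def Yv_def monom_altdef)
  ultimately have q2: "CC c dvd swap q2 - Q"
    by (simp add: swap_hom algebra_simps)
  have degQ: "degree Q = CHAR('a)"
  proof (rule antisym)
    show "degree Q \<le> CHAR('a)" unfolding Q_def using p_ge_2
      by (intro degree_add_le order.trans[OF degree_monom_le] order.trans[OF degree_pCons_le]) auto
    show "CHAR('a) \<le> degree Q"
      using p_ge_2 by (intro le_degree) (auto simp: Q_def coeff_pCons split: nat.splits)
  qed
  then have lcQ: "lead_coeff Q = 1"
    using p_ge_2 by (auto simp: Q_def coeff_pCons split: nat.splits)
  note q = dvd_swap_q_diff[OF ca]
  have q1: "CC c dvd swap q1 - [:\<rho>:]"
  proof -
    obtain E where "q1 = inY \<rho> + CC b * (Xv + E)"
      using q1_expand(2) by blast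
    then have "CC c dvd q1 - inY \<rho>" using cb by simp
    then show ?thesis using hom_dvd[OF is_ring_hom_swap, of "CC c"] by (fastforce simp: swap_hom)
  qed
  obtain W where W: "w = poly (map_poly (\<lambda>P. eval2 P q q1) W) q2"
    using B_as_poly_q2[OF assms(3)] ..
  have "CC c dvd swap (poly (map_poly (\<lambda>P. eval2 P q q1) W) q2) - pcompose (map_poly ?h W) Q" for W
  proof (induction W)
    case 0
    show ?case by (simp add: swap_def)
  next
    case (pCons P W)
    have "CC c dvd eval2 P (swap q) (swap q1) - [:?h P:]"
      using eval2_dvd_diff[OF q q1, of P] unfolding eval2_const_const .
    then have "CC c dvd (eval2 P (swap q) (swap q1) +
        swap q2 * swap (poly (map_poly (\<lambda>P. eval2 P q q1) W) q2))
        - ([:?h P:] + Q * pcompose (map_poly ?h W) Q)"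
      by (intro dvd_diff_add CC_dvd_diff_mult q2 pCons.IH)
    then show ?case
      by (simp add: hom_eval_pCons[OF is_ring_hom_eval2] swap_hom swap_eval2
          map_poly_pCons pcompose_pCons)
  qed
  moreover have "CC c dvd swap w" using assms(4) by (simp add: CC_dvd_swap_iff)
  ultimately have "CC c dvd pcompose (map_poly ?h W) Q"
    unfolding W by (metis dvd_of_dvd_diff)
  then have "[:[:c:]:] dvd map_poly ?h W"
    unfolding CC_def
    by (rule const_dvd_pcompose[OF lift_prime_elem_poly[OF assms(1)], rotated 2])
       (use assms(1) char_pos in \<open>auto simp: degQ lcQ[unfolded degQ] prime_elem_def is_unit_const_poly_iff\<close>)
  then have "[:c:] dvd ?h (coeff W i)" for i
    unfolding const_poly_dvd_iff[of "[:c:]"] by (simp add: coeff_map_poly)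
  then have *: "\<exists>v\<in>B. eval2 (coeff W i) q q1 = CC c * v" for i
    by (rule eval2_in_prime_multiple[OF assms(1,2)])
  have "\<exists>v\<in>B. poly (map_poly (\<lambda>P. eval2 P q q1) W) q2 = CC c * v"
    using *
  proof (induction W)
    case 0
    show ?case using subalg_CC[OF is_subalg_B, of 0] by (intro bexI[of _ 0]) simp_all
  next
    case (pCons P W)
    obtain v where v: "v \<in> B" "eval2 P q q1 = CC c * v" using pCons.prems[of 0] by auto
    obtain v' where v': "v' \<in> B" "poly (map_poly (\<lambda>P. eval2 P q q1) W) q2 = CC c * v'"
      using pCons.IH pCons.prems[of "Suc _"] by auto
    have "poly (map_poly (\<lambda>P. eval2 P q q1) (pCons P W)) q2 = CC c * (v + q2 * v')"
      by (simp add: hom_eval_pCons[OF is_ring_hom_eval2] v(2) v'(2) algebra_simps)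
    moreover have "v + q2 * v' \<in> B"
      using v(1) v'(1) gens_in_B is_subalg_B by (auto intro: subalg_intros)
    ultimately show ?case by blast
  qed
  then show ?thesis unfolding W .
qed

text \<open>One prime of \<open>c\<close> is cancelled at a time by
  \<open>prime_multiple_in_B\<close>.\<close>

lemma B_saturated:
  assumes "c \<noteq> 0" "\<And>x. prime x \<Longrightarrow> x dvd c \<Longrightarrow> x dvd b" "CC c * g \<in> B"
  shows "g \<in> B"
  using assms
proof (induction c arbitrary: g rule: prime_divisors_induct)
  case (unit c)
  obtain c' where c': "1 = c * c'" using unit.hyps by (rule dvdE)
  have "g = CC (c * c') * g" by (simp flip: c')
  then have "g = CC c' * (CC c * g)" by (simp add: CC_mult mult_ac)
  then show ?case using unit.prems subalg_mult[OF is_subalg_B subalg_CC[OF is_subalg_B]] by metis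
next
  case (factor x c)
  have "CC x dvd CC (x * c) * g" by (simp add: CC_mult mult.assoc)
  then obtain v where v: "v \<in> B" "CC (x * c) * g = CC x * v"
    using prime_multiple_in_B[of x] factor.hyps factor.prems(2)[of x] factor.prems(3) by auto
  have "x \<noteq> 0" using factor.prems(1) by auto
  with v(2) have "CC c * g = v" by (simp add: CC_mult mult.assoc)
  with factor v(1) show ?case by simp
qed simp

text \<open>Primes of \<open>c\<close> not dividing \<open>b\<close> cancel from \<open>P\<close>
  itself; each one dividing \<open>b\<close> is traded for a factor \<open>b\<close> on the
  left.\<close>

lemma clear_denominator:
  assumes "c \<noteq> 0" "\<And>x. prime x \<Longrightarrow> x dvd c \<Longrightarrow> x dvd a" "CC c * g = eval2 P q q1"
  shows "\<exists>k P'. CC (b ^ k) * g = eval2 P' q q1"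
  using assms
proof (induction c arbitrary: g P rule: prime_divisors_induct)
  case (unit c)
  obtain c' where c': "1 = c * c'" using unit.hyps by (rule dvdE)
  have "g = CC (c * c') * g" by (simp flip: c')
  then have "g = CC c' * (CC c * g)" by (simp add: CC_mult mult_ac)
  then have "CC (b ^ 0) * g = eval2 (CC c' * P) q q1"
    unfolding unit.prems(3) by (simp add: eval2_hom)
  then show ?case by blast
next
  case (factor x c)
  have x: "x \<noteq> 0" "x dvd a" "prime_elem x" using factor.prems(1,2) factor.hyps by auto
  show ?case
  proof (cases "x dvd b")
    case True
    then obtain e where e: "b = x * e" ..
    have "CC c * (CC b * g) = CC e * (CC (x * c) * g)" by (simp add: e CC_mult mult_ac)
    also have "\<dots> = eval2 (CC e * P) q q1" by (simp add: factor.prems(3) eval2_hom)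
    finally have "\<exists>k P'. CC (b ^ k) * (CC b * g) = eval2 P' q q1"
      by (rule factor.IH[rotated 2]) (use factor.prems(1,2) in auto)
    then obtain k P' where "CC (b ^ k) * (CC b * g) = eval2 P' q q1" by blast
    then have "CC (b ^ Suc k) * g = eval2 P' q q1" by (simp add: CC_mult mult_ac)
    then show ?thesis by blast
  next
    case False
    have "CC x dvd eval2 P q q1"
      unfolding factor.prems(3)[symmetric] by (simp add: CC_mult mult.assoc)
    then obtain P' where P': "P = CC x * P'"
      using prime_const_dvd_eval2[OF x(3,2) False] by blast
    have "CC c * g = eval2 P' q q1"
      using factor.prems(3) x(1) unfolding P' by (simp add: eval2_hom CC_mult mult.assoc)
    then show ?thesis by (rule factor.IH[rotated 2]) (use factor.prems(1,2) in auto)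
  qed
qed simp

section \<open>Invariants over the fraction field\<close>

text \<open>After \<open>swap\<close>, \<open>f\<close> has degree one in the outer variable x with
  leading coefficient \<open>a\<close>, so composition with it is injective.\<close>

lemma eval2_f_Yv_injective:
  assumes "eval2 P f Yv = 0"
  shows "P = 0"
proof -
  let ?f = "[:\<theta>, [:a:]:]"
  have "swap f = CC a * Yv + [:\<theta>:]" by (simp add: nag_f_def swap_hom)
  then have "swap f = ?f" by (simp add: CC_def Yv_def)
  then have sw: "swap (eval2 P f Yv) = eval2 P ?f Xv" by (simp add: swap_eval2)
  have pc: "pcompose (CC r) ?f = CC r" "pcompose Xv ?f = Xv" "pcompose Yv ?f = ?f" for r
    by (simp_all add: CC_def Xv_def Yv_def pcompose_pCons)
  have "eval2 P ?f Xv = pcompose (swap P) ?f"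
    by (rule bipoly_hom_eqI[of "\<lambda>P. eval2 P ?f Xv" "\<lambda>P. pcompose (swap P) ?f"])
       (auto intro: is_ring_hom_eval2 is_ring_hom_comp[OF is_ring_hom_pcompose is_ring_hom_swap]
         simp: pc)
  then have "pcompose (swap P) ?f = 0" using assms sw by (simp add: swap_def)
  then have "swap P = 0" by (rule pcompose_eq_0) (use a_nz in simp)
  then have "swap (swap P) = 0" by (simp add: swap_def)
  then show ?thesis by simp
qed

lemma eval2_pcompose:
  "eval2 (pcompose P Q) g h = eval2 P g (eval2 Q g h)"
  by (induction P) (simp_all add: pcompose_pCons eval2_pCons eval2_hom)

text \<open>Since a x is \<open>f\<close> minus \<open>\<theta>\<close>, inverting \<open>a\<close>
  makes \<open>f\<close> and y coordinates; stated by multiplication to avoid fractions.\<close>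

lemma power_a_mult_in_range: "\<exists>n P. CC (a ^ n) * g = eval2 P f Yv"
proof (induction g rule: bipoly_induct)
  case (const r)
  have "CC (a ^ 0) * CC r = eval2 (CC r) f Yv" by simp
  then show ?case by blast
next
  case X
  have "CC (a ^ 1) * Xv = eval2 (Xv - inY \<theta>) f Yv"
    by (simp add: eval2_hom nag_f_def inY_eq_evalY eval2_evalY)
  then show ?case by blast
next
  case Y
  have "CC (a ^ 0) * Yv = eval2 Yv f Yv" by simp
  then show ?case by blast
next
  case (add g h)
  then obtain n P m Q where *: "CC (a ^ n) * g = eval2 P f Yv" "CC (a ^ m) * h = eval2 Q f Yv"
    by blast
  have "CC (a ^ (n + m)) * (g + h) = CC (a ^ m) * (CC (a ^ n) * g) + CC (a ^ n) * (CC (a ^ m) * h)"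
    by (simp add: power_add CC_mult algebra_simps)
  also have "\<dots> = eval2 (CC (a ^ m) * P + CC (a ^ n) * Q) f Yv"
    by (simp add: * eval2_hom)
  finally show ?case by blast
next
  case (mult g h)
  then obtain n P m Q where *: "CC (a ^ n) * g = eval2 P f Yv" "CC (a ^ m) * h = eval2 Q f Yv"
    by blast
  have "CC (a ^ (n + m)) * (g * h) = (CC (a ^ n) * g) * (CC (a ^ m) * h)"
    by (simp add: power_add CC_mult algebra_simps)
  also have "\<dots> = eval2 (P * Q) f Yv"
    by (simp add: * eval2_hom)
  finally show ?case by blast
qed

text \<open>In the coordinates \<open>f\<close> and y, \<open>\<phi>\<close> translates y by a
  polynomial in the fixed element \<open>f\<close>. Hence \<open>translation_invariant\<close> gives
  a polynomial in \<open>f\<close> and \<open>q\<close>, and \<open>f\<close> is itself one in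
  \<open>q\<close> and \<open>q1\<close>.\<close>

lemma power_a_mult_invariant:
  assumes "\<phi> g = g"
  shows "\<exists>n P. CC (a ^ n) * g = eval2 P q q1"
proof -
  obtain n P where P: "CC (a ^ n) * g = eval2 P f Yv"
    using power_a_mult_in_range by blast
  let ?u = "smult a Fp"
  have u: "evalY ?u f = u"
    using hom_mult[OF is_ring_hom_evalY, of "[:a:]" Fp f] by (simp add: nag_F_def)
  have "eval2 (pcompose P [:?u, 1:]) f Yv = eval2 P f (Yv + u)"
    by (simp add: eval2_pcompose eval2_pCons u hom_one[OF is_ring_hom_evalY] add.commute del: evalY_const)
  also have "\<dots> = \<phi> (eval2 P f Yv)" by (simp add: phi_eval2 phi_f phi_Yv)
  also have "\<dots> = eval2 P f Yv"
    unfolding P[symmetric] by (simp add: phi_hom phi_CC assms)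
  finally have "eval2 (pcompose P [:?u, 1:] - P) f Yv = 0" by (simp add: eval2_hom)
  then have "pcompose P [:?u, 1:] = P" using eval2_f_Yv_injective by fastforce
  moreover have "?u \<noteq> 0"
    using F_nz a_nz by (auto simp: nag_F_def)
  ultimately obtain Q where Q: "P = pcompose Q ([:0, 1:] ^ CHAR('a poly)
      - smult (?u ^ (CHAR('a poly) - 1)) [:0, 1:])"
    using translation_invariant[of ?u P] prime_p by auto
  have "eval2 ([:0, 1:] ^ CHAR('a poly) - smult (?u ^ (CHAR('a poly) - 1)) [:0, 1:]) f Yv = q"
  proof -
    have "smult (?u ^ (CHAR('a) - 1)) [:0, 1:] = [:?u:] ^ (CHAR('a) - 1) * Yv"
      by (simp add: Yv_def poly_const_pow)
    then show ?thesis
      unfolding semiring_char_poly by (simp add: Yv_def[symmetric] eval2_hom nag_q_def u)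
  qed
  then have "CC (a ^ n) * g = eval2 Q f q"
    unfolding P Q eval2_pcompose by simp
  also have "f = eval2 (CC d * Yv + [:\<theta>s:]) q q1"
    by (simp add: eval2_hom q1_expand(1))
  \<comment> \<open>The outer variable of \<open>Q\<close> receives \<open>q\<close>, which is the
    value of \<open>Xv\<close> at (\<open>q\<close>, \<open>q1\<close>).\<close>
  also have "eval2 Q \<dots> q = eval2 (eval2 Q (CC d * Yv + [:\<theta>s:]) Xv) q q1"
    by (simp add: eval2_eval2)
  finally show ?thesis by blast
qed

lemma invariants_eq: "{g. \<phi> g = g} = B"
proof (intro set_eqI iffI)
  fix g assume "g \<in> {g. \<phi> g = g}"
  then obtain n P where "CC (a ^ n) * g = eval2 P q q1"
    using power_a_mult_invariant by blast
  \<comment> \<open>The denominator is first reduced to a power of \<open>b\<close> using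
    \<open>q\<close> and \<open>q1\<close> alone; \<open>q2\<close> enters only with
    \<open>B_saturated\<close>.\<close>
  then have "\<exists>k P'. CC (b ^ k) * g = eval2 P' q q1"
    by (rule clear_denominator[rotated 2]) (use a_nz in \<open>auto dest: prime_dvd_power\<close>)
  then obtain k P' where k: "CC (b ^ k) * g = eval2 P' q q1" by blast
  have "CC (b ^ k) * g \<in> B"
    unfolding k using is_subalg_B gens_in_B by (intro subalg_eval2)
  then show "g \<in> B"
    by (rule B_saturated[rotated 2]) (use b_nz in \<open>auto dest: prime_dvd_power\<close>)
qed (simp add: subalg_invariant)

end

theorem theorem6p16:
  fixes a :: "'a::{factorial_ring_gcd, semiring_gcd_mult_normalize}"
    and \<theta> :: "'a poly" and Fp :: "'a poly" and lam :: "'a bipoly"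
  assumes "CHAR('a) > 0"
    and "a \<noteq> 0"
    and "\<theta> \<noteq> 0" and "poly \<theta> 0 = 0"
    and "nag_F a \<theta> Fp \<noteq> 0"
    and "inY (pderiv (nag_rho a \<theta>)) ^ CHAR('a) * Yv = eval2 lam (Yv ^ CHAR('a)) (inY (nag_rho a \<theta>))"
  shows "{g. nag_phi a \<theta> Fp g = g} =
         subalg {nag_q a \<theta> Fp, nag_q1 a \<theta> Fp, nag_q2 a \<theta> Fp lam}"
proof -
  interpret nagata a \<theta> Fp lam
    by standard (use assms in simp_all)
  show ?thesis by (rule invariants_eq)
qed

end
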